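(* Let $p$ be a prime, $q=p^m$, $1\le r<p$, and let $d(p,m,r)$ be as defined in the context. Then $$1+p\,(q-d(p,m,r))\le 1+q+\frac{(r-1)(p-1)}{2}\lfloor 2\sqrt{q}\rfloor.$$
   Context: Enumerate $\mathbb{F}_q^*=\{\alpha_1,\dots,\alpha_{q-1}\}$ and fix an $\mathbb{F}_p$-linear isomorphism $\mathbb{F}_q\cong\mathbb{F}_p^m$. Let $A\in\mathbb{F}_p^{rm\times(q-1)}$ be the matrix whose $j$-th column is the concatenation of the coordinate vectors of $\alpha_j,\alpha_j^2,\dots,\alpha_j^r$. Let $C$ be the $\mathbb{F}_p$-row space of $A$ and $d(p,m,r)$ its minimum Hamming distance. *)

theory Defs
  imports Complex_Main "HOL-Library.Cardinality" "HOL-Computational_Algebra.Primes"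
begin

text \<open>F_p is represented by the residues {0..<p} with arithmetic mod p.
  A coordinate map phi : F_q -> F_p^m is a function 'a => nat => nat whose values
  are vectors v with v i < p for i < m and v i = 0 for i >= m.\<close>

definition coord_vectors :: "nat \<Rightarrow> nat \<Rightarrow> (nat \<Rightarrow> nat) set" where
  "coord_vectors p m = {v. (\<forall>i<m. v i < p) \<and> (\<forall>i\<ge>m. v i = 0)}"

definition Fp_linear_iso :: "nat \<Rightarrow> nat \<Rightarrow> ('a::field \<Rightarrow> nat \<Rightarrow> nat) \<Rightarrow> bool" where
  "Fp_linear_iso p m \<phi> \<longleftrightarrow>
     bij_betw \<phi> UNIV (coord_vectors p m) \<and>
     (\<forall>x y. \<phi> (x + y) = (\<lambda>i. if i < m then (\<phi> x i + \<phi> y i) mod p else 0)) \<and>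
     (\<forall>c x. c < p \<longrightarrow> \<phi> (of_nat c * x) = (\<lambda>i. if i < m then (c * \<phi> x i) mod p else 0))"

text \<open>Row space of A over F_p: A has rows indexed by (k,i), 1 <= k <= r, i < m,
  columns indexed by j < q-1, with entry A_{(k,i),j} = phi (alpha_j ^ k) i.
  A codeword is an F_p-linear combination of rows (coefficients lam k i < p),
  viewed as a function on column indices (zero outside {0..<q-1}).\<close>

definition row_space ::
  "nat \<Rightarrow> nat \<Rightarrow> nat \<Rightarrow> ('a::{field,finite} \<Rightarrow> nat \<Rightarrow> nat) \<Rightarrow> (nat \<Rightarrow> 'a) \<Rightarrow> (nat \<Rightarrow> nat) set" where
  "row_space p m r \<phi> \<alpha> =
     {c. \<exists>lam :: nat \<Rightarrow> nat \<Rightarrow> nat. (\<forall>k i. lam k i < p) \<and>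
        c = (\<lambda>j. if j < card (UNIV :: 'a set) - 1
                   then (\<Sum>k\<in>{1..r}. \<Sum>i<m. lam k i * \<phi> (\<alpha> j ^ k) i) mod p
                   else 0)}"

definition hamming_weight :: "(nat \<Rightarrow> nat) \<Rightarrow> nat" where
  "hamming_weight c = card {j. c j \<noteq> 0}"

definition min_distance :: "(nat \<Rightarrow> nat) set \<Rightarrow> nat" where
  "min_distance C = Min (hamming_weight ` (C - {\<lambda>_. 0}))"

end

theory Submission
  imports "HOL-Algebra.Algebraic_Closure_Type" "HOL-Number_Theory.Cong" Defs
begin

text \<open>
  A nonzero codeword is \<open>x \<mapsto> Tr (f x)\<close> for some \<open>f = a\<^sub>1 x + \<dots> + a\<^sub>d x\<^sup>d\<close> with \<open>a\<^sub>d \<noteq> 0\<close>, \<open>1 \<le> d \<le> r\<close>, so \<open>p\<close> times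
  its number of zeros is \<open>q\<close> plus the sum over \<open>0 < t < p\<close> of the exponential sums \<open>S\<^sub>t\<close> with
  terms \<open>\<zeta>\<close> to the power \<open>t Tr (f x)\<close>. The corresponding sums over the degree-\<open>n\<close> extensions are
  \<open>-\<Sum> w\<^sup>n\<close>, where \<open>w\<close> runs through the \<open>d - 1\<close> reciprocal roots of an L-polynomial whose top
  coefficient has absolute value \<open>q\<close> to the power \<open>(d - 1)/2\<close>, by orthogonality of characters. Stepanov's
  method bounds the sums over extensions of even degree, so \<open>|w| \<le> \<surd>q\<close>, and the top coefficient
  forces equality. The product of the L-polynomials over all \<open>t\<close> has integer coefficients; hence
  \<open>\<Prod> (\<lfloor>2\<surd>q\<rfloor> + 1 + w + cnj w)\<close> is a positive integer, and the arithmetic-geometric mean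
  inequality (Serre's trick) bounds \<open>-\<Sum> Re w\<close>.
\<close>

hide_const (open) Divisibility.prime

subsection \<open>Finite subfields and additive characters\<close>

text \<open>The result is the Hasse-Weil-Serre bound for the curve y^p - y = f(x) of genus
  (p-1)(d-1)/2, reached through characters instead of the theory of curves. The condition r < p
  makes d prime to p. This enters three times: in the distinct degrees of Stepanov's method, in the
  vanishing of the L-coefficients from index d on, and in the modulus of the top coefficient.
  Stepanov's method splits the Frobenius of the field into two equal halves, hence the even degrees;
  these suffice, as the moduli of the roots are read off from a growth rate and any constant in the
  estimate will do. Bounding the roots one by one would leave 2 sqrt q unrounded. Rounding down
  needs integers, whereas a single L-polynomial has coefficients in a cyclotomic ring, so all t are
  taken together; it also needs the exact moduli, since the functional equation rests on cnj w = q /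
  w. All extensions are fixed sets of Frobenius powers in one algebraically closed field, so a
  single type serves every degree.\<close>

definition fixed_field :: "nat \<Rightarrow> 'k::field set" where
  "fixed_field N = {x. x ^ N = x}"

lemma size_eq_card_set_mset:
  assumes "\<And>x. x \<in># A \<Longrightarrow> count A x = 1"
  shows "size A = card (set_mset A)"
  using assms by (simp add: size_multiset_overloaded_eq)

lemma proots_prod_linear:
  "proots (\<Prod>x\<in>#A. [:-x, 1:]) = (A :: 'k::field multiset)"
proof (induction A)
  case (add x A)
  have "(\<Prod>x\<in>#A. [:-x, 1:]) \<noteq> 0" by (auto simp: prod_mset_zero_iff)
  then show ?case
    using add by (simp add: proots_mult del: mult_pCons_left)
qed simp

lemma card_roots_eq_degree:
  fixes P :: "'k::alg_closed_field poly"
  assumes "rsquarefree P"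
  shows "card {x. poly P x = 0} = degree P"
proof -
  have P0: "P \<noteq> 0" using assms by (simp add: rsquarefree_def)
  obtain A where A: "size A = degree P" "P = smult (lead_coeff P) (\<Prod>x\<in>#A. [:-x, 1:])"
    using alg_closed_imp_factorization[OF P0] by blast
  have "proots P = proots (\<Prod>x\<in>#A. [:-x, 1:])"
    using P0 by (subst A(2)) (simp add: proots_smult)
  also have "\<dots> = A"
    by (rule proots_prod_linear)
  finally have pA: "proots P = A" .
  have "size A = card (set_mset A)"
  proof (rule size_eq_card_set_mset)
    fix x assume "x \<in># A"
    then show "count A x = 1"
      using assms P0 unfolding pA[symmetric] rsquarefree_def
      by (metis count_greater_zero_iff count_proots gr_implies_not0)
  qed
  moreover have "set_mset A = {x. poly P x = 0}"
    using P0 pA set_count_proots by blast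
  ultimately show ?thesis using A(1) by simp
qed

lemma rsquarefreeI_pderiv:
  fixes P :: "'k::field poly"
  assumes "\<And>a. poly (pderiv P) a \<noteq> 0"
  shows "rsquarefree P"
  unfolding rsquarefree_def
proof (intro conjI allI)
  show P0: "P \<noteq> 0" using assms by auto
  fix a
  show "order a P = 0 \<or> order a P = 1"
  proof (rule ccontr)
    assume "\<not> ?thesis"
    then have "[:-a, 1:] ^ 2 dvd [:-a, 1:] ^ order a P" by (intro le_imp_power_dvd) auto
    then have "[:-a, 1:] ^ 2 dvd P" using order_1 by (rule dvd_trans)
    then obtain Q where "P = [:-a, 1:] ^ 2 * Q" by (elim dvdE)
    then have "P = [:-a, 1:] * ([:-a, 1:] * Q)" by (simp only: power2_eq_square mult.assoc)
    then have "poly (pderiv P) a = 0" by (simp add: pderiv_mult del: mult_pCons_left)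
    then show False using assms by blast
  qed
qed

section \<open>Frobenius and its fixed fields in an algebraically closed field\<close>

locale char_p =
  fixes p :: nat and k_type :: "'k::alg_closed_field itself"
  assumes prime_p: "prime p" and char_k: "CHAR('k) = p"
begin

lemma p_pos: "p > 0" and p_gt1: "p > 1"
  using prime_p prime_gt_1_nat prime_gt_0_nat by auto

lemma of_nat_p [simp]: "of_nat p = (0::'k)"
  using char_k of_nat_CHAR by metis

lemma of_nat_eq_0_iff: "of_nat c = (0::'k) \<longleftrightarrow> p dvd c"
  using char_k of_nat_eq_0_iff_char_dvd by metis

lemma frob_add: "(x + y :: 'k) ^ (p ^ n) = x ^ (p ^ n) + y ^ (p ^ n)"
  by (rule freshmans_dream') (auto simp: char_k prime_p)

lemma frob_sum: "(\<Sum>i\<in>A. g i :: 'k) ^ (p ^ n) = (\<Sum>i\<in>A. g i ^ (p ^ n))"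
  by (rule freshmans_dream_sum'[of _ n]) (auto simp: char_k prime_p)

lemma frob_minus: "(- x :: 'k) ^ (p ^ n) = - (x ^ (p ^ n))"
proof -
  have "(x + - x) ^ (p ^ n) = x ^ (p ^ n) + (- x) ^ (p ^ n)" by (rule frob_add)
  then show ?thesis using p_pos by (simp add: power_0_left add_eq_0_iff)
qed

lemma frob_inj: "x ^ (p ^ n) = (y::'k) ^ (p ^ n) \<Longrightarrow> x = y"
proof -
  assume "x ^ (p ^ n) = y ^ (p ^ n)"
  then have "(x + - y) ^ (p ^ n) = 0" by (simp only: frob_add frob_minus) simp
  then show "x = y" by (simp add: power_eq_0_iff)
qed

text \<open>\<open>X ^ (p ^ n) - X\<close> has derivative -1 in characteristic \<open>p\<close>,
  hence as many distinct roots as its degree.\<close>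

lemma card_fixed_field:
  assumes "n > 0"
  shows "card (fixed_field (p ^ n) :: 'k set) = p ^ n" 
proof -
  define P :: "'k poly" where "P = monom 1 (p ^ n) - monom 1 1"
  have N: "p ^ n > 1" using one_less_power[OF p_gt1] assms by blast
  have pd: "pderiv P = - 1"
    using assms by (simp add: P_def pderiv_diff pderiv_monom)
  have "rsquarefree P"
    using N by (intro rsquarefreeI_pderiv) (simp add: pd)
  then have "card {x. poly P x = 0} = degree P" by (rule card_roots_eq_degree)
  moreover have "degree P = p ^ n"
    unfolding P_def diff_conv_add_uminus using N
    by (subst degree_add_eq_left) (auto simp: degree_monom_eq)
  moreover have "{x. poly P x = 0} = fixed_field (p ^ n)"
    by (auto simp: P_def fixed_field_def poly_monom)
  ultimately show ?thesis by simp
qed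

lemma finite_fixed_field: "n > 0 \<Longrightarrow> finite (fixed_field (p ^ n) :: 'k set)"
  using card_fixed_field[of n] p_pos card_ge_0_finite by force

lemma fixed_field_0 [simp]: "n > 0 \<Longrightarrow> (0::'k) \<in> fixed_field n"
  and fixed_field_1 [simp]: "(1::'k) \<in> fixed_field n"
  by (auto simp: fixed_field_def)

lemma fixed_field_mult: "x \<in> fixed_field n \<Longrightarrow> y \<in> fixed_field n \<Longrightarrow> (x * y::'k) \<in> fixed_field n"
  and fixed_field_inverse: "x \<in> fixed_field n \<Longrightarrow> (inverse x::'k) \<in> fixed_field n"
  and fixed_field_divide: "x \<in> fixed_field n \<Longrightarrow> y \<in> fixed_field n \<Longrightarrow> (x / y::'k) \<in> fixed_field n"
  and fixed_field_power: "x \<in> fixed_field n \<Longrightarrow> (x ^ j::'k) \<in> fixed_field n"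
  by (auto simp: fixed_field_def power_mult_distrib power_inverse power_divide)
     (metis power_mult mult.commute)

lemma fixed_field_add: "x \<in> fixed_field (p ^ n) \<Longrightarrow> y \<in> fixed_field (p ^ n) \<Longrightarrow> (x + y::'k) \<in> fixed_field (p ^ n)"
  and fixed_field_minus: "x \<in> fixed_field (p ^ n) \<Longrightarrow> (- x::'k) \<in> fixed_field (p ^ n)"
  by (auto simp: fixed_field_def frob_add frob_minus)

lemma fixed_field_diff: "x \<in> fixed_field (p ^ n) \<Longrightarrow> y \<in> fixed_field (p ^ n) \<Longrightarrow> (x - y::'k) \<in> fixed_field (p ^ n)"
  using fixed_field_add[of x n "-y"] fixed_field_minus by simp

lemma fixed_field_sum: "(\<And>i. i \<in> A \<Longrightarrow> g i \<in> fixed_field (p ^ n)) \<Longrightarrow> (\<Sum>i\<in>A. g i :: 'k) \<in> fixed_field (p ^ n)"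
  by (auto simp: fixed_field_def frob_sum)

lemma fixed_field_of_nat: "(of_nat c :: 'k) \<in> fixed_field (p ^ n)"
  using p_pos by (induction c) (auto intro: fixed_field_add)

lemma fixed_field_mono: "m dvd n \<Longrightarrow> x \<in> fixed_field (p ^ m) \<Longrightarrow> (x::'k) \<in> fixed_field (p ^ n)"
proof (elim dvdE)
  fix k assume x: "x \<in> fixed_field (p ^ m)" and n: "n = m * k"
  have "x ^ (p ^ (m * k)) = x"
  proof (induction k)
    case (Suc k)
    have "x ^ (p ^ (m * Suc k)) = (x ^ (p ^ (m * k))) ^ (p ^ m)"
      by (simp add: power_add power_mult[symmetric] mult.commute)
    then show ?case using Suc x by (simp add: fixed_field_def)
  qed simp
  then show ?thesis by (simp add: fixed_field_def n)
qed

text \<open>Lifts an element of the prime field to an exponent for \<open>zeta\<close>; outside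
  \<open>fixed_field p\<close> the value is unspecified.\<close>

definition residue :: "'k \<Rightarrow> nat" where
  "residue x = (THE c. c < p \<and> of_nat c = x)"

lemma of_nat_inj_on: "inj_on (of_nat :: nat \<Rightarrow> 'k) {..<p}"
proof (rule linorder_inj_onI)
  fix x y assume xy: "x < y" "x \<in> {..<p}" "y \<in> {..<p}"
  then have "\<not> p dvd y - x" by (auto dest: dvd_imp_le)
  then show "(of_nat x :: 'k) \<noteq> of_nat y"
    using of_nat_eq_iff_char_dvd[OF xy(1), where 'a='k] char_k by simp
qed auto

lemma residue_of_nat: "c < p \<Longrightarrow> residue (of_nat c) = c"
  unfolding residue_def
  by (rule the_equality) (auto dest: inj_onD[OF of_nat_inj_on])

lemma prime_field: "(fixed_field p :: 'k set) = of_nat ` {..<p}"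
proof (rule card_subset_eq[symmetric])
  show "finite (fixed_field p :: 'k set)" using finite_fixed_field[of 1] by simp
  show "of_nat ` {..<p} \<subseteq> (fixed_field p :: 'k set)" using fixed_field_of_nat[of _ 1] by auto
  show "card (of_nat ` {..<p} :: 'k set) = card (fixed_field p :: 'k set)"
    using card_fixed_field[of 1] by (simp add: card_image of_nat_inj_on)
qed

lemma of_nat_residue: "x \<in> fixed_field p \<Longrightarrow> of_nat (residue x) = x"
  and residue_less: "x \<in> fixed_field p \<Longrightarrow> residue x < p"
  by (auto simp: prime_field residue_of_nat)

lemma of_nat_mod_p: "(of_nat (c mod p) :: 'k) = of_nat c"
  by (metis add.right_neutral div_mult_mod_eq mult_zero_right of_nat_add of_nat_mult of_nat_p add.commute)

lemma residue_of_nat_mod: "residue (of_nat c) = c mod p"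
  using residue_of_nat[of "c mod p"] p_pos by (simp add: of_nat_mod_p)

lemma residue_0 [simp]: "residue 0 = 0"
  using residue_of_nat[of 0] p_pos by simp

lemma residue_add: "x \<in> fixed_field p \<Longrightarrow> y \<in> fixed_field p \<Longrightarrow> residue (x + y) = (residue x + residue y) mod p"
  by (metis of_nat_add of_nat_residue residue_of_nat_mod)

section \<open>The absolute trace\<close>

definition abs_trace :: "nat \<Rightarrow> 'k \<Rightarrow> 'k" where
  "abs_trace m y = (\<Sum>i<m. y ^ (p ^ i))"

lemma abs_trace_add: "abs_trace m (x + y) = abs_trace m x + abs_trace m y"
  by (simp add: abs_trace_def frob_add sum.distrib)

lemma abs_trace_0 [simp]: "abs_trace m 0 = 0"
  using p_pos by (simp add: abs_trace_def power_0_left)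

lemma abs_trace_sum: "abs_trace m (\<Sum>i\<in>A. g i) = (\<Sum>i\<in>A. abs_trace m (g i))"
  by (induction A rule: infinite_finite_induct) (auto simp: abs_trace_add)

lemma abs_trace_of_nat_mult: "abs_trace m (of_nat c * x) = of_nat c * abs_trace m x"
  by (induction c) (auto simp: abs_trace_add algebra_simps)

lemma abs_trace_in:
  assumes "y \<in> fixed_field (p ^ m)"
  shows "abs_trace m y \<in> fixed_field p"
proof -
  have "abs_trace m y ^ p = (\<Sum>i<m. (y ^ (p ^ i)) ^ p)"
    unfolding abs_trace_def using frob_sum[of "\<lambda>i. y ^ (p ^ i)" "{..<m}" 1] by simp
  also have "\<dots> = (\<Sum>i<m. y ^ (p ^ Suc i))"
    by (simp add: power_mult[symmetric] mult.commute)
  also have "\<dots> = (\<Sum>i<m. y ^ (p ^ i))"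
    using assms sum.lessThan_Suc_shift[of "\<lambda>i. y ^ (p ^ i)" m]
    by (simp add: sum.lessThan_Suc fixed_field_def)
  finally show ?thesis by (simp add: abs_trace_def fixed_field_def)
qed

text \<open>Transitivity of the trace, a rearrangement of the exponents as \<open>m * i + j\<close>.
  It expresses sums over extensions through the character of the base field.\<close>

lemma abs_trace_mult: "abs_trace (m * n) y = abs_trace m (\<Sum>i<n. y ^ ((p ^ m) ^ i))"
proof -
  have "abs_trace m (\<Sum>i<n. y ^ ((p ^ m) ^ i)) = (\<Sum>i<n. \<Sum>j<m. y ^ (p ^ (m * i + j)))"
    by (subst abs_trace_sum) (simp add: abs_trace_def power_mult[symmetric] power_add)
  also have "\<dots> = (\<Sum>k<n * m. y ^ (p ^ k))"
  proof -
    have "(\<Sum>i<n. \<Sum>j<m. y ^ (p ^ (m * i + j))) = (\<Sum>i<n. sum (\<lambda>k. y ^ (p ^ k)) {i * m..<i * m + m})"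
    proof (rule sum.cong[OF refl])
      fix i show "(\<Sum>j<m. y ^ (p ^ (m * i + j))) = sum (\<lambda>k. y ^ (p ^ k)) {i * m..<i * m + m}"
        by (rule sum.reindex_bij_witness[of _ "\<lambda>k. k - i * m" "\<lambda>j. m * i + j"]) (auto simp: mult.commute)
    qed
    also have "\<dots> = (\<Sum>k<n * m. y ^ (p ^ k))" by (rule sum.nat_group)
    finally show ?thesis .
  qed
  finally show ?thesis by (simp add: abs_trace_def mult.commute)
qed

text \<open>The trace is a nonzero polynomial of degree at most \<open>p ^ (m - 1)\<close>, too
  small to vanish on \<open>p ^ m\<close> elements.\<close>

lemma abs_trace_nonzero:
  assumes "m > 0"
  obtains y where "y \<in> fixed_field (p ^ m)" "abs_trace m y \<noteq> 0"
proof -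
  define P :: "'k poly" where "P = (\<Sum>i<m. monom 1 (p ^ i))"
  have "coeff P 1 = (\<Sum>i<m. if i = 0 then 1 else 0)"
    unfolding P_def coeff_sum using p_gt1 by (intro sum.cong) (auto simp: power_eq_1_iff)
  also have "\<dots> = 1" using assms by (simp add: sum.delta)
  finally have P0: "P \<noteq> 0" by auto
  have "degree P \<le> p ^ (m - 1)"
    unfolding P_def
  proof (rule degree_sum_le)
    fix i assume "i \<in> {..<m}"
    then show "degree (monom (1::'k) (p ^ i)) \<le> p ^ (m - 1)"
      using p_pos by (auto simp: degree_monom_eq intro!: power_increasing)
  qed simp
  also have "\<dots> < p ^ m" using p_gt1 assms by (simp add: power_strict_increasing)
  finally have "card {x. poly P x = 0} < p ^ m"
    using card_poly_roots_bound[OF P0] by linarith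
  then have "\<not> fixed_field (p ^ m) \<subseteq> {x. poly P x = 0}"
    using card_mono[OF poly_roots_finite[OF P0], of "fixed_field (p ^ m)"] card_fixed_field[OF assms]
    by linarith
  then show ?thesis using that
    by (auto simp: P_def poly_sum poly_monom abs_trace_def)
qed

section \<open>Powers of a primitive p-th root of unity\<close>

definition zeta :: complex where "zeta = cis (2 * pi / real p)"

lemma zeta_power: "zeta ^ k = cis (2 * pi * real k / real p)"
  by (simp add: zeta_def DeMoivre mult_ac)

lemma zeta_p [simp]: "zeta ^ p = 1"
  using p_pos by (simp add: zeta_power)

lemma zeta_power_mod: "zeta ^ (k mod p) = zeta ^ k"
proof -
  have "zeta ^ k = zeta ^ (p * (k div p) + k mod p)" by simp
  also have "\<dots> = zeta ^ (k mod p)" unfolding power_add power_mult by simp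
  finally show ?thesis by simp
qed

lemma norm_zeta [simp]: "norm (zeta ^ k) = 1"
  by (simp add: zeta_power)

lemma zeta_power_eq_1_iff: "zeta ^ k = 1 \<longleftrightarrow> p dvd k"
proof
  assume "zeta ^ k = 1"
  then have "cos (2 * pi * real k / real p) = 1"
    by (simp add: zeta_power complex_eq_iff)
  then obtain x :: int where "2 * pi * real k / real p = of_int x * 2 * pi"
    using cos_one_2pi_int by blast
  then have "real k = of_int x * real p" using p_pos by (simp add: field_simps)
  then have "int k = x * int p" by (metis of_int_eq_iff of_int_mult of_int_of_nat_eq)
  then have "int p dvd int k" by simp
  then show "p dvd k" by simp
next
  assume "p dvd k" then show "zeta ^ k = 1" by (auto simp: power_mult)
qed

lemma cnj_zeta: 
  assumes "t < p"
  shows "cnj (zeta ^ (t * c)) = zeta ^ ((p - t) * c)"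
proof -
  have "zeta ^ ((p - t) * c) * zeta ^ (t * c) = 1"
    using assms by (simp add: power_add[symmetric] add_mult_distrib[symmetric]) (simp add: power_mult)
  moreover have "cnj (zeta ^ (t * c)) * zeta ^ (t * c) = 1"
    using complex_norm_square[of "zeta ^ (t * c)"] by (simp add: mult.commute)
  ultimately show ?thesis
    by (metis mult_cancel_right mult_zero_right zero_neq_one)
qed

lemma sum_zeta: "(\<Sum>t<p. zeta ^ (t * c)) = (if p dvd c then of_nat p else 0)"
proof (cases "p dvd c")
  case True
  then have "zeta ^ (t * c) = 1" for t by (auto simp: zeta_power_eq_1_iff)
  then show ?thesis using True by simp
next
  case False
  then have "zeta ^ c \<noteq> 1" by (simp add: zeta_power_eq_1_iff)
  moreover have "(zeta ^ c) ^ p = 1" by (metis mult.commute power_mult power_one zeta_p)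
  ultimately have "(\<Sum>t<p. (zeta ^ c) ^ t) = 0" by (subst geometric_sum) auto
  then show ?thesis using False by (simp add: power_mult[symmetric] mult.commute)
qed

end

subsection \<open>Stepanov's method for the trace of a polynomial\<close>

text \<open>Gaussian elimination on the coefficient of index \<open>N\<close>. The family is
  indexed, so equal polynomials count as different unknowns.\<close>

lemma poly_linear_dependence:
  fixes P :: "'i \<Rightarrow> 'k::field poly"
  assumes "finite S" "card S > N" "\<And>s i. s \<in> S \<Longrightarrow> i \<ge> N \<Longrightarrow> coeff (P s) i = 0"
  shows "\<exists>c. (\<exists>s\<in>S. c s \<noteq> 0) \<and> (\<Sum>s\<in>S. smult (c s) (P s)) = 0"
  using assms
proof (induction N arbitrary: S P)
  case 0
  then have "P s = 0" if "s \<in> S" for s using that by (intro poly_eqI) auto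
  moreover have "S \<noteq> {}" using 0 by auto
  ultimately show ?case by (intro exI[of _ "\<lambda>_. 1"]) auto
next
  case (Suc N)
  show ?case
  proof (cases "\<forall>s\<in>S. coeff (P s) N = 0")
    case True
    then have "coeff (P s) i = 0" if "s \<in> S" "i \<ge> N" for s i
      using that Suc.prems(3)[of s i] by (cases "i = N") auto
    then show ?thesis using Suc.IH[of S P] Suc.prems by auto
  next
    case False
    then obtain s0 where s0: "s0 \<in> S" "coeff (P s0) N \<noteq> 0" by auto
    define r where "r s = coeff (P s) N / coeff (P s0) N" for s
    define P' where "P' s = P s - smult (r s) (P s0)" for s
    have "\<exists>c. (\<exists>s\<in>S - {s0}. c s \<noteq> 0) \<and> (\<Sum>s\<in>S - {s0}. smult (c s) (P' s)) = 0"
    proof (rule Suc.IH)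
      show "card (S - {s0}) > N" using Suc.prems s0 by simp
      fix s i assume si: "s \<in> S - {s0}" "i \<ge> N"
      show "coeff (P' s) i = 0"
        using si s0 Suc.prems(3)[of s i] Suc.prems(3)[of s0 i]
        by (cases "i = N") (auto simp: P'_def r_def)
    qed (use Suc.prems in auto)
    then obtain c where c: "\<exists>s\<in>S - {s0}. c s \<noteq> 0" "(\<Sum>s\<in>S - {s0}. smult (c s) (P' s)) = 0" by blast
    \<comment> \<open>The pivot absorbs the multiples of \<open>P s0\<close> that were subtracted in
      \<open>P'\<close>.\<close>
    define c' where "c' = c(s0 := - (\<Sum>s\<in>S - {s0}. c s * r s))"
    have "(\<Sum>s\<in>S. smult (c' s) (P s)) = smult (c' s0) (P s0) + (\<Sum>s\<in>S - {s0}. smult (c s) (P s))"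
      using s0 Suc.prems(1) by (subst sum.remove[of S s0]) (auto simp: c'_def)
    also have "(\<Sum>s\<in>S - {s0}. smult (c s) (P s)) = (\<Sum>s\<in>S - {s0}. smult (c s) (P' s) + smult (c s * r s) (P s0))"
      by (intro sum.cong) (auto simp: P'_def smult_diff_right)
    also have "\<dots> = smult (\<Sum>s\<in>S - {s0}. c s * r s) (P s0)"
      by (simp add: sum.distrib c(2) smult_sum)
    also have "smult (c' s0) (P s0) + \<dots> = 0" by (simp add: c'_def)
    finally have "(\<Sum>s\<in>S. smult (c' s) (P s)) = 0" .
    moreover have "\<exists>s\<in>S. c' s \<noteq> 0" using c(1) by (auto simp: c'_def)
    ultimately show ?thesis by blast
  qed
qed

text \<open>Among the terms with nonzero coefficient the one of largest degree is unique, so nothing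
  cancels its leading coefficient.\<close>

lemma sum_distinct_degrees_nonzero:
  fixes T :: "'i \<Rightarrow> 'k::field poly"
  assumes "finite S" "inj_on (\<lambda>s. degree (T s)) S" "\<And>s. s \<in> S \<Longrightarrow> T s \<noteq> 0"
    and "\<exists>s\<in>S. c s \<noteq> 0"
  shows "(\<Sum>s\<in>S. smult (c s) (T s)) \<noteq> 0"
proof -
  define S' where "S' = {s\<in>S. c s \<noteq> 0}"
  have S': "finite S'" "S' \<noteq> {}" using assms by (auto simp: S'_def)
  define M where "M = Max ((\<lambda>s. degree (T s)) ` S')"
  have "M \<in> (\<lambda>s. degree (T s)) ` S'" unfolding M_def using S' by (intro Max_in) auto
  then obtain s0 where s0: "s0 \<in> S'" "M = degree (T s0)" by auto
  have "c s * coeff (T s) M = (if s = s0 then c s0 * coeff (T s0) M else 0)" if "s \<in> S" for s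
  proof (cases "s = s0 \<or> c s = 0")
    case False
    then have "s \<in> S'" using that by (simp add: S'_def)
    then have "degree (T s) \<le> M" unfolding M_def using S' by (intro Max_ge) auto
    moreover have "degree (T s) \<noteq> M"
      using False s0 that inj_onD[OF assms(2), of s s0] by (auto simp: S'_def)
    ultimately show ?thesis using False by (simp add: coeff_eq_0)
  qed auto
  then have "coeff (\<Sum>s\<in>S. smult (c s) (T s)) M = (\<Sum>s\<in>S. if s = s0 then c s0 * coeff (T s0) M else 0)"
    unfolding coeff_sum coeff_smult by (intro sum.cong) auto
  also have "\<dots> = c s0 * coeff (T s0) M" using s0 assms(1) by (simp add: sum.delta S'_def)
  also have "\<dots> \<noteq> 0" using s0 assms(3)[of s0] by (auto simp: S'_def)
  finally show ?thesis by auto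
qed

context char_p
begin

lemma degree_trace_poly:
  fixes f :: "'k poly"
  assumes "degree f > 0"
  shows "degree (\<Sum>i<Suc n. f ^ (p ^ i)) = degree f * p ^ n"
proof (induction n)
  case (Suc n)
  have f0: "f \<noteq> 0" using assms by auto
  have "degree (\<Sum>i<Suc n. f ^ (p ^ i)) < degree (f ^ (p ^ Suc n))"
    using Suc assms p_gt1 f0 by (simp add: degree_power_eq mult.commute)
  then have "degree ((\<Sum>i<Suc n. f ^ (p ^ i)) + f ^ (p ^ Suc n)) = degree (f ^ (p ^ Suc n))"
    by (rule degree_add_eq_right)
  then show ?case using f0 by (simp add: degree_power_eq mult_ac)
qed simp

text \<open>With \<open>s = p\<^sup>\<mu>\<close> and \<open>h = f + f\<^sup>p + \<dots>\<close> (\<open>\<mu>\<close> terms), the points counted satisfy \<open>x\<^bsup>s s\<^esup> = x\<close>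
  and \<open>h\<^sup>s = a - h\<close>. Hence the \<open>s\<close>-th power of \<open>g = \<Sum> e X\<^bsup>b + i s\<^esup> h\<^sup>j\<close> coincides at these points with
  \<open>\<Sum> e\<^sup>s X\<^bsup>b s + i\<^esup> (a - h)\<^sup>j\<close>, and by linear algebra the coefficients can be chosen so that the latter
  vanishes identically. The terms of \<open>g\<close> have distinct degrees, so \<open>g \<noteq> 0\<close>.\<close>

lemma stepanov_bound:
  fixes f :: "'k poly" and a :: 'k
  assumes d: "degree f = d" "\<not> p dvd d" and mu: "\<mu> > 0"
  shows "card {x \<in> fixed_field (p ^ (2 * \<mu>)). abs_trace (2 * \<mu>) (poly f x) = a}
           \<le> p ^ (2 * \<mu> - 1) + (2 * d + 1) * p ^ \<mu>"
proof -
  have d0: "d > 0" using d by (auto intro: gr0I)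
  define s' where "s' = p ^ (\<mu> - 1)"
  define s where "s = p ^ \<mu>"
  have s: "s = p * s'" using mu by (simp add: s_def s'_def power_eq_if)
  have s'0: "s' > 0" using p_pos by (simp add: s'_def)
  have s0: "s > 0" using p_pos by (simp add: s_def)
  have ss: "s * s = p ^ (2 * \<mu>)" by (simp add: s_def power_add[symmetric] mult_2)
  have ss': "s * s' = p ^ (2 * \<mu> - 1)"
    using mu by (simp add: s_def s'_def power_add[symmetric] mult_2)
  define h where "h = (\<Sum>i<\<mu>. f ^ (p ^ i))"
  have dh: "degree h = d * s'"
    using degree_trace_poly[of f "\<mu> - 1"] d d0 mu by (simp add: h_def s'_def)
  have h0: "h \<noteq> 0" using dh d0 s'0 by auto
  \<comment> \<open>The degree of \<open>T (b, i, j)\<close> is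
    \<open>b + s' * (i * p + j * d)\<close>: with \<open>b < s'\<close> and \<open>j < p\<close> it
    determines \<open>b\<close> modulo \<open>s'\<close>, then \<open>j\<close> modulo
    \<open>p\<close>. The range of \<open>i\<close> makes the number of unknowns exceed
    \<open>N\<close>, by \<open>(p - 1) * s' + d * (s' - 1)\<close>.\<close>
  define S where "S = {..<s'} \<times> {..<s' + d} \<times> {..<p}"
  have finS: "finite S" by (simp add: S_def)
  define P where "P = (\<lambda>(b, i, j). monom 1 (b * s + i) * ([:a:] - h) ^ j)"
  define T where "T = (\<lambda>(b, i, j). monom 1 (b + i * s) * h ^ j)"
  define N where "N = (s' - 1) * s + (s' + d) + (p - 1) * d * s'"
  have "\<exists>c. (\<exists>t\<in>S. c t \<noteq> 0) \<and> (\<Sum>t\<in>S. smult (c t) (P t)) = 0"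
  proof (rule poly_linear_dependence[OF finS])
    obtain k where k: "s' = Suc k" using s'0 by (cases s') auto
    obtain r where r: "p = Suc r" using p_pos by (cases p) auto
    have "r > 0" using r p_gt1 by simp
    have "card S = s' * ((s' + d) * p)" by (simp add: S_def card_cartesian_product)
    also have "\<dots> = N + r * Suc k + d * k"
      unfolding N_def s unfolding k r by (simp add: algebra_simps)
    finally show "N < card S" using \<open>r > 0\<close> by simp
    fix t i assume t: "t \<in> S" "i \<ge> N"
    obtain b i' j where tt: "t = (b, i', j)" by (cases t)
    have bij: "b < s'" "i' < s' + d" "j < p" using t by (auto simp: S_def tt)
    have "degree ([:a:] - h) \<le> d * s'"
      using degree_diff_le_max[of "[:a:]" h] by (simp add: dh)
    then have "degree (([:a:] - h) ^ j) \<le> (d * s') * j"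
      using degree_power_le[of "[:a:] - h" j] by (meson le_trans mult_le_mono1)
    also have "\<dots> \<le> (d * s') * (p - 1)" using bij by (intro mult_le_mono) auto
    finally have "degree (P t) \<le> b * s + i' + (d * s') * (p - 1)"
      unfolding P_def tt using degree_mult_le[of "monom (1::'k) (b * s + i')" "([:a:] - h) ^ j"]
      by (simp add: degree_monom_eq)
    also have "\<dots> < (s' - 1) * s + (s' + d) + (d * s') * (p - 1)"
    proof -
      have "b * s \<le> (s' - 1) * s" using bij by (intro mult_le_mono) auto
      then show ?thesis using bij by linarith
    qed
    also have "\<dots> = N" by (simp add: N_def)
    finally show "coeff (P t) i = 0" using t by (intro coeff_eq_0) linarith
  qed
  then obtain c where c: "\<exists>t\<in>S. c t \<noteq> 0" "(\<Sum>t\<in>S. smult (c t) (P t)) = 0" by blast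
  \<comment> \<open>The linear system fixes the \<open>s\<close>-th powers of the coefficients of
    \<open>g\<close>; the roots exist by algebraic closedness.\<close>
  define e where "e t = (SOME y. y ^ s = c t)" for t
  have e: "e t ^ s = c t" for t
    unfolding e_def by (rule someI_ex) (rule nth_root_exists[OF s0])
  define g where "g = (\<Sum>t\<in>S. smult (e t) (T t))"
  have degT: "degree (T (b, i, j)) = b + s' * (i * p + j * d)" for b i j
  proof -
    have "degree (T (b, i, j)) = (b + i * s) + d * s' * j"
      unfolding T_def using h0 by (simp add: degree_mult_eq degree_monom_eq degree_power_eq dh)
    then show ?thesis by (simp add: s algebra_simps)
  qed
  have "g \<noteq> 0"
    unfolding g_def
  proof (rule sum_distinct_degrees_nonzero[OF finS])
    show "T t \<noteq> 0" for t using h0 by (auto simp: T_def split: prod.splits)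
    show "\<exists>t\<in>S. e t \<noteq> 0" using c(1) e s0 by (metis power_0_left less_numeral_extra(3))
    show "inj_on (\<lambda>t. degree (T t)) S"
    proof (rule inj_onI)
      fix t u assume tu: "t \<in> S" "u \<in> S" "degree (T t) = degree (T u)"
      obtain b i j where t: "t = (b, i, j)" by (cases t)
      obtain b' i' j' where u: "u = (b', i', j')" by (cases u)
      have bnd: "b < s'" "b' < s'" "j < p" "j' < p" using tu by (auto simp: S_def t u)
      have eq: "b + s' * (i * p + j * d) = b' + s' * (i' * p + j' * d)"
        using tu(3) unfolding t u degT .
      have bb: "b = b'" using arg_cong[OF eq, of "\<lambda>x. x mod s'"] bnd by simp
      then have eq': "i * p + j * d = i' * p + j' * d" using eq s'0 by simp
      have "[j * d = j' * d] (mod p)"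
        using arg_cong[OF eq', of "\<lambda>x. x mod p"] by (simp add: cong_def)
      moreover have "coprime d p" using prime_p d(2) prime_imp_coprime coprime_commute by blast
      ultimately have "[j = j'] (mod p)" using cong_mult_rcancel_nat by blast
      then have jj: "j = j'" using bnd by (simp add: cong_def)
      then have "i = i'" using eq' p_pos by simp
      then show "t = u" using bb jj t u by simp
    qed
  qed
  have "{x \<in> fixed_field (p ^ (2 * \<mu>)). abs_trace (2 * \<mu>) (poly f x) = a} \<subseteq> {x. poly g x = 0}"
  proof safe
    fix x assume x: "x \<in> fixed_field (p ^ (2 * \<mu>))" and tr: "a = abs_trace (2 * \<mu>) (poly f x)"
    have xss: "x ^ (s * s) = x" using x by (simp add: ss fixed_field_def)
    have hx: "poly h x = (\<Sum>i<\<mu>. poly f x ^ (p ^ i))" by (simp add: h_def poly_sum)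
    have "poly h x ^ s = (\<Sum>i<\<mu>. poly f x ^ (p ^ (\<mu> + i)))"
      unfolding hx s_def frob_sum by (simp add: power_mult[symmetric] power_add mult.commute)
    \<comment> \<open>The \<open>2 * \<mu>\<close> terms of the trace are those of \<open>h\<close>
      followed by their \<open>s\<close>-th powers.\<close>
    then have "poly h x + poly h x ^ s = a"
      unfolding hx tr abs_trace_def mult_2 lessThan_atLeast0
      by (subst sum.atLeastLessThan_concat[of 0 \<mu> "\<mu> + \<mu>", symmetric])
         (auto simp: sum.shift_bounds_nat_ivl[of _ 0 \<mu> \<mu>, simplified] add.commute)
    then have hs: "poly h x ^ s = a - poly h x" by (simp add: algebra_simps)
    have "poly g x ^ s = (\<Sum>t\<in>S. (e t * poly (T t) x) ^ s)"
      unfolding g_def s_def by (simp add: poly_sum frob_sum)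
    also have "\<dots> = (\<Sum>t\<in>S. c t * poly (P t) x)"
    proof (rule sum.cong[OF refl])
      fix t assume "t \<in> S"
      obtain b i j where t: "t = (b, i, j)" by (cases t)
      have "poly (T t) x ^ s = x ^ (b * s) * (x ^ (s * s)) ^ i * (poly h x ^ s) ^ j"
        by (simp add: T_def t poly_monom power_mult_distrib power_mult[symmetric] power_add algebra_simps)
      also have "\<dots> = poly (P t) x"
        by (simp add: xss hs P_def t poly_monom power_add)
      finally show "(e t * poly (T t) x) ^ s = c t * poly (P t) x"
        by (simp add: power_mult_distrib e)
    qed
    also have "\<dots> = poly (\<Sum>t\<in>S. smult (c t) (P t)) x" by (simp add: poly_sum)
    also have "\<dots> = 0" by (simp add: c(2))
    finally show "poly g x = 0" using s0 by simp
  qed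
  then have "card {x \<in> fixed_field (p ^ (2 * \<mu>)). abs_trace (2 * \<mu>) (poly f x) = a} \<le> card {x. poly g x = 0}"
    using poly_roots_finite[OF \<open>g \<noteq> 0\<close>] by (rule card_mono[rotated])
  also have "\<dots> \<le> degree g" by (rule card_poly_roots_bound[OF \<open>g \<noteq> 0\<close>])
  \<comment> \<open>\<open>s * s'\<close> is the average size of a fibre of the trace, and
    \<open>s\<close> is the square root of the size of the field.\<close>
  also have "\<dots> \<le> s * s' + (2 * d + 1) * s"
    unfolding g_def
  proof (rule degree_sum_le[OF finS])
    fix t assume "t \<in> S"
    moreover obtain b i j where t: "t = (b, i, j)" by (cases t)
    ultimately have bij: "b < s'" "i < s' + d" "j < p" by (auto simp: S_def)
    have "degree (smult (e t) (T t)) \<le> b + s' * (i * p + j * d)"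
      using degree_smult_le[of "e t" "T t"] by (simp add: t degT)
    also have "\<dots> \<le> s' + s' * ((s' + d) * p + p * d)"
      using bij by (intro add_mono mult_le_mono) auto
    also have "\<dots> \<le> s + s' * ((s' + d) * p + p * d)" using p_pos by (simp add: s)
    also have "\<dots> = s * s' + (2 * d + 1) * s" by (simp add: s algebra_simps)
    finally show "degree (smult (e t) (T t)) \<le> s * s' + (2 * d + 1) * s" .
  qed
  finally show ?thesis by (simp only: ss' s_def[symmetric])
qed

end

subsection \<open>The L-polynomial of an additive character\<close>

text \<open>The reindexing argument behind both orthogonality relations for the L-coefficients: the
  sum is \<open>\<kappa>\<close> times itself.\<close>

lemma sum_eq_0_by_bij:
  fixes F :: "'a \<Rightarrow> 'b::field"
  assumes "bij_betw \<pi> S S" "\<And>v. v \<in> S \<Longrightarrow> F (\<pi> v) = \<kappa> * F v" "\<kappa> \<noteq> 1"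
  shows "sum F S = 0"
proof -
  have "sum F S = (\<Sum>v\<in>S. F (\<pi> v))"
    using sum.reindex_bij_betw[OF assms(1), of F] by simp
  also have "\<dots> = \<kappa> * sum F S" by (simp add: assms(2) sum_distrib_left)
  finally show ?thesis using assms(3) by simp
qed

text \<open>The minus sign lets the factor \<open>1 - x T\<close> contribute
  \<open>x ^ Suc j\<close> with a plus sign.\<close>

definition fps_log_deriv :: "'k::field fps \<Rightarrow> 'k fps" where
  "fps_log_deriv u = - fps_deriv u * inverse u"

lemma fps_log_deriv_mult:
  assumes "u $ 0 \<noteq> 0" "v $ 0 \<noteq> (0::'k::field)"
  shows "fps_log_deriv (u * v) = fps_log_deriv u + fps_log_deriv v"
proof -
  have "u * inverse u = 1" "v * inverse v = 1"
    using assms inverse_mult_eq_1' by blast+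
  moreover have "- (fps_deriv u * v + u * fps_deriv v) * (inverse u * inverse v)
      = - fps_deriv u * inverse u * (v * inverse v) - fps_deriv v * inverse v * (u * inverse u)"
    by (simp add: algebra_simps)
  moreover have "fps_log_deriv (u * v) = - (fps_deriv u * v + u * fps_deriv v) * (inverse u * inverse v)"
    by (simp add: fps_log_deriv_def fps_inverse_mult add.commute)
  ultimately show ?thesis by (simp add: fps_log_deriv_def)
qed

lemma fps_log_deriv_1 [simp]: "fps_log_deriv 1 = 0"
  by (simp add: fps_log_deriv_def)

lemma fps_log_deriv_linear:
  "fps_log_deriv (1 - fps_const x * fps_X) = Abs_fps (\<lambda>j. x ^ Suc j :: 'k::field)"
proof -
  let ?u = "1 - fps_const x * fps_X"
  have u0: "?u $ 0 \<noteq> 0" by simp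
  have "Abs_fps (\<lambda>j. x ^ Suc j) * ?u = fps_const x"
  proof (rule fps_ext)
    fix n
    have "Abs_fps (\<lambda>j. x ^ Suc j) * ?u = Abs_fps (\<lambda>j. x ^ Suc j) - fps_X * (fps_const x * Abs_fps (\<lambda>j. x ^ Suc j))"
      by (simp add: algebra_simps)
    then show "(Abs_fps (\<lambda>j. x ^ Suc j) * ?u) $ n = fps_const x $ n"
      by (cases n) auto
  qed
  then have "Abs_fps (\<lambda>j. x ^ Suc j) * (?u * inverse ?u) = fps_const x * inverse ?u"
    by (metis mult.assoc)
  then have "Abs_fps (\<lambda>j. x ^ Suc j) = fps_const x * inverse ?u"
    using inverse_mult_eq_1'[OF u0] by simp
  then show ?thesis by (simp add: fps_log_deriv_def)
qed

text \<open>\<open>d < p\<close> makes \<open>of_nat d * a d\<close> nonzero, the factor with which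
  the top coefficient enters the character. The polynomial starts at index 1, like the rows of the
  code.\<close>

locale artin_schreier = char_p p k_type
  for p :: nat and k_type :: "'k::alg_closed_field itself" +
  fixes m d :: nat and a :: "nat \<Rightarrow> 'k"
  assumes m_pos: "m > 0" and d_pos: "d > 0" and d_less: "d < p"
    and a_in: "\<And>i. a i \<in> fixed_field (p ^ m)" and a_d: "a d \<noteq> 0"
begin

abbreviation "Fq \<equiv> (fixed_field (p ^ m) :: 'k set)"

lemmas Fq_closed [simp, intro] =
  fixed_field_add[where n = m] fixed_field_minus[where n = m] fixed_field_diff[where n = m]
  fixed_field_mult[where n = "p ^ m"] fixed_field_inverse[where n = "p ^ m"]
  fixed_field_power[where n = "p ^ m"] fixed_field_sum[where n = m] fixed_field_of_nat[where n = m] 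
  fixed_field_1[where n = "p ^ m"]

lemma Fq_0 [simp]: "0 \<in> Fq" using p_pos by simp

lemma card_Fq: "card Fq = p ^ m" and finite_Fq [simp]: "finite Fq"
  using card_fixed_field finite_fixed_field m_pos by auto

lemma of_nat_d_nonzero: "(of_nat d :: 'k) \<noteq> 0"
  using d_pos d_less by (auto simp: of_nat_eq_0_iff dest: dvd_imp_le)

definition eps :: "nat \<Rightarrow> 'k \<Rightarrow> complex" where
  "eps t y = zeta ^ (t * residue (abs_trace m y))"

lemma eps_0 [simp]: "eps t 0 = 1"
  by (simp add: eps_def)

lemma norm_eps [simp]: "norm (eps t y) = 1"
  by (simp add: eps_def)

lemma eps_add: "x \<in> Fq \<Longrightarrow> y \<in> Fq \<Longrightarrow> eps t (x + y) = eps t x * eps t y"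
proof -
  assume "x \<in> Fq" "y \<in> Fq"
  then have "residue (abs_trace m (x + y)) = (residue (abs_trace m x) + residue (abs_trace m y)) mod p"
    by (simp add: abs_trace_add residue_add abs_trace_in)
  then have "eps t (x + y) = (zeta ^ ((residue (abs_trace m x) + residue (abs_trace m y)) mod p)) ^ t"
    by (simp add: eps_def power_mult[symmetric] mult.commute)
  also have "\<dots> = (zeta ^ residue (abs_trace m x)) ^ t * (zeta ^ residue (abs_trace m y)) ^ t"
    by (simp add: zeta_power_mod power_add power_mult_distrib)
  finally show ?thesis by (simp add: eps_def power_mult[symmetric] mult.commute)
qed

lemma eps_nontrivial:
  assumes "0 < t" "t < p" "c \<in> Fq" "c \<noteq> 0"
  obtains \<delta> where "\<delta> \<in> Fq" "eps t (c * \<delta>) \<noteq> 1"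
proof -
  obtain y where y: "y \<in> Fq" "abs_trace m y \<noteq> 0"
    using abs_trace_nonzero[OF m_pos] .
  have tr: "abs_trace m y \<in> fixed_field p" using y by (intro abs_trace_in)
  have "\<not> p dvd residue (abs_trace m y)"
    using y of_nat_residue[OF tr] of_nat_eq_0_iff by metis
  moreover have "\<not> p dvd t" using assms by (auto dest: dvd_imp_le)
  ultimately have "eps t y \<noteq> 1"
    using prime_p by (simp add: eps_def zeta_power_eq_1_iff prime_dvd_mult_iff)
  then show ?thesis using that[of "inverse c * y"] y assms
    by (auto simp: mult.assoc[symmetric])
qed

text \<open>On a product of factors \<open>1 - \<theta> T\<close> this is the sum of the values \<open>f \<theta>\<close>, since the coefficients of
  the logarithmic derivative are the power sums; see \<open>char_fun_lin_prod\<close> below.\<close>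

definition char_fun :: "'k fps \<Rightarrow> 'k" where
  "char_fun u = (\<Sum>i\<in>{1..d}. a i * fps_log_deriv u $ (i - 1))"

lemma char_fun_mult: "u $ 0 \<noteq> 0 \<Longrightarrow> v $ 0 \<noteq> 0 \<Longrightarrow> char_fun (u * v) = char_fun u + char_fun v"
  by (simp add: char_fun_def fps_log_deriv_mult distrib_left sum.distrib)

lemma char_fun_1 [simp]: "char_fun 1 = 0"
  by (simp add: char_fun_def)

lemma char_fun_principal:
  assumes "w $ 0 = 1" "\<And>i. 0 < i \<Longrightarrow> i < d \<Longrightarrow> w $ i = 0"
  shows "char_fun w = - (of_nat d * a d * w $ d)"
proof -
  have "fps_log_deriv w $ j = (if j = d - 1 then - (of_nat d * w $ d) else 0)" if "j < d" for j
  proof -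
    have "fps_log_deriv w $ j = - (\<Sum>i=0..j. of_nat (Suc i) * w $ Suc i * inverse w $ (j - i))"
      by (simp add: fps_log_deriv_def fps_mult_nth)
    also have "(\<Sum>i=0..j. of_nat (Suc i) * w $ Suc i * inverse w $ (j - i))
        = (\<Sum>i=0..j. if i = d - 1 then of_nat d * w $ d else 0)"
    proof (rule sum.cong[OF refl])
      fix i assume i: "i \<in> {0..j}"
      show "of_nat (Suc i) * w $ Suc i * inverse w $ (j - i) = (if i = d - 1 then of_nat d * w $ d else 0)"
      proof (cases "i = d - 1")
        case True
        then have "Suc i = d" "j - i = 0" using d_pos that i by auto
        then show ?thesis using True assms(1) by simp
      next
        case False
        then have "Suc i < d" using i that by auto
        then show ?thesis using False assms(2)[of "Suc i"] by simp
      qed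
    qed
    also have "\<dots> = (if j = d - 1 then of_nat d * w $ d else 0)"
      using that by (auto simp: sum.delta)
    finally show ?thesis by auto
  qed
  then have "char_fun w = (\<Sum>i\<in>{1..d}. if i = d then - (of_nat d * a d * w $ d) else 0)"
    unfolding char_fun_def
  proof (intro sum.cong refl)
    fix i assume eq: "\<And>j. j < d \<Longrightarrow> fps_log_deriv w $ j = (if j = d - 1 then - (of_nat d * w $ d) else 0)"
      and i: "i \<in> {1..d}"
    then have "i - 1 < d" "i - 1 = d - 1 \<longleftrightarrow> i = d" by auto
    then show "a i * fps_log_deriv w $ (i - 1) = (if i = d then - (of_nat d * a d * w $ d) else 0)"
      by (simp add: eq)
  qed
  also have "\<dots> = - (of_nat d * a d * w $ d)" using d_pos by (simp add: sum.delta)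
  finally show ?thesis .
qed

text \<open>\<open>v = u * w\<close>, where \<open>w\<close> is as in
  \<open>char_fun_principal\<close>: modulo \<open>T ^ d\<close> its logarithmic derivative is a
  single term, met only by \<open>a d\<close>. So the coefficient of index \<open>d\<close> enters
  affinely and the higher ones not at all.\<close>

lemma char_fun_change_top:
  assumes "u $ 0 = 1" "v $ 0 = 1" "\<And>i. i < d \<Longrightarrow> u $ i = v $ i"
  shows "char_fun v = char_fun u - of_nat d * a d * (v $ d - u $ d)"
proof -
  define w where "w = 1 + (v - u) * inverse u"
  have nz: "((v - u) * inverse u) $ i = 0" if "i < d" for i
    using that assms(3) by (simp add: fps_mult_nth)
  have wd: "((v - u) * inverse u) $ d = v $ d - u $ d"
  proof -
    have "((v - u) * inverse u) $ d = (\<Sum>i=0..d. if i = d then v $ d - u $ d else 0)"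
      unfolding fps_mult_nth using assms by (intro sum.cong) (auto simp: le_less)
    then show ?thesis by (simp add: sum.delta)
  qed
  have uu: "u * inverse u = 1" using assms by (intro inverse_mult_eq_1') simp
  have "u * w = u + (v - u) * (u * inverse u)" by (simp add: w_def algebra_simps)
  then have "v = u * w" by (simp add: uu)
  moreover have w0: "w $ 0 = 1" using nz[of 0] d_pos by (simp add: w_def)
  moreover have "char_fun w = - (of_nat d * a d * (v $ d - u $ d))"
  proof (subst char_fun_principal[OF w0])
    show "w $ i = 0" if "0 < i" "i < d" for i using nz that by (simp add: w_def)
    show "- (of_nat d * a d * w $ d) = - (of_nat d * a d * (v $ d - u $ d))"
      using wd d_pos by (simp add: w_def)
  qed
  ultimately show ?thesis using assms by (simp add: char_fun_mult)
qed

lemma inverse_fps_Fq: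
  assumes "u $ 0 = 1" "\<And>i. u $ i \<in> Fq"
  shows "inverse u $ n \<in> Fq"
proof (induction n rule: less_induct)
  case (less n)
  show ?case
  proof (cases "n = 0")
    case False
    have "(u * inverse u) $ n = 0" using False assms by (simp add: inverse_mult_eq_1')
    then have "inverse u $ n = - (\<Sum>i=1..n. u $ i * inverse u $ (n - i))"
      using assms(1) by (simp add: fps_mult_nth sum.atLeast_Suc_atMost add_eq_0_iff2)
    also have "\<dots> \<in> Fq"
      using assms less by (intro fixed_field_minus fixed_field_sum fixed_field_mult) auto
    finally show ?thesis .
  qed (use assms in simp)
qed

lemma char_fun_Fq:
  assumes "u $ 0 = 1" "\<And>i. u $ i \<in> Fq"
  shows "char_fun u \<in> Fq"
  unfolding char_fun_def fps_log_deriv_def using assms a_in inverse_fps_Fq[OF assms]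
  by (auto simp: fps_mult_nth intro!: fixed_field_sum fixed_field_mult fixed_field_minus fixed_field_add
        fixed_field_of_nat)

text \<open>The reversals of the monic polynomials of degree \<open>k\<close> over \<open>\<bbbF>\<^sub>q\<close>.\<close>

definition unit_polys :: "nat \<Rightarrow> 'k fps set" where
  "unit_polys k = {v. v $ 0 = 1 \<and> (\<forall>i. v $ i \<in> Fq) \<and> (\<forall>i>k. v $ i = 0)}"

lemma card_unit_polys: "card (unit_polys k) = (p ^ m) ^ k"
  and finite_unit_polys [simp]: "finite (unit_polys k)"
proof -
  define F where "F g = Abs_fps (\<lambda>i. if i = 0 then 1 else if i \<le> k then g i else (0::'k))" for g
  have "bij_betw F (Pi\<^sub>E {1..k} (\<lambda>_. Fq)) (unit_polys k)"
  proof (rule bij_betwI[where g = "\<lambda>v. restrict (\<lambda>i. v $ i) {1..k}"])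
    show "F \<in> (Pi\<^sub>E {1..k} (\<lambda>_. Fq)) \<rightarrow> unit_polys k"
      by (auto simp: F_def unit_polys_def PiE_def Pi_def)
    show "(\<lambda>v. restrict (\<lambda>i. v $ i) {1..k}) \<in> unit_polys k \<rightarrow> (Pi\<^sub>E {1..k} (\<lambda>_. Fq))"
      by (auto simp: unit_polys_def)
    show "restrict (\<lambda>i. F x $ i) {1..k} = x" if "x \<in> (Pi\<^sub>E {1..k} (\<lambda>_. Fq))" for x
      using that by (auto simp: F_def fun_eq_iff PiE_def extensional_def restrict_def)
    show "F (restrict (\<lambda>i. y $ i) {1..k}) = y" if "y \<in> unit_polys k" for y
      using that by (auto simp: F_def unit_polys_def fps_eq_iff not_le)
  qed
  moreover have "card (Pi\<^sub>E {1..k} (\<lambda>_. Fq)) = (p ^ m) ^ k"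
    by (simp add: card_PiE card_Fq)
  moreover have "finite (Pi\<^sub>E {1..k} (\<lambda>_. Fq))" by (intro finite_PiE) auto
  ultimately show "card (unit_polys k) = (p ^ m) ^ k" "finite (unit_polys k)"
    using bij_betw_same_card bij_betw_finite by fastforce+
qed

lemma unit_polysD: "v \<in> unit_polys k \<Longrightarrow> v $ 0 = 1" "v \<in> unit_polys k \<Longrightarrow> v $ i \<in> Fq"
    "v \<in> unit_polys k \<Longrightarrow> i > k \<Longrightarrow> v $ i = 0"
  by (auto simp: unit_polys_def)

lemma bij_unit_polys_shift:
  assumes "0 < j" "j \<le> k" "\<delta> \<in> Fq"
  shows "bij_betw (\<lambda>v. v + fps_const \<delta> * fps_X ^ j) (unit_polys k) (unit_polys k)"
  by (rule bij_betwI[where g = "\<lambda>v. v - fps_const \<delta> * fps_X ^ j"])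
     (use assms in \<open>auto simp: unit_polys_def\<close>)

definition chi :: "nat \<Rightarrow> 'k fps \<Rightarrow> complex" where
  "chi t v = eps t (char_fun v)"

text \<open>The coefficient of \<open>T ^ k\<close> in the L-series, a sum over the monic
  polynomials of degree \<open>k\<close> through their reversals.\<close>

definition L_coeff :: "nat \<Rightarrow> nat \<Rightarrow> complex" where
  "L_coeff t k = (\<Sum>v\<in>unit_polys k. chi t v)"

lemma unit_polys_0: "unit_polys 0 = {1}"
  by (auto simp: unit_polys_def fps_eq_iff)

lemma L_coeff_0: "L_coeff t 0 = 1"
  by (simp add: L_coeff_def unit_polys_0 chi_def)

text \<open>For \<open>k \<ge> d\<close> the coefficient of index \<open>d\<close> can be shifted
  freely, and the shift multiplies \<open>chi\<close> by a nontrivial value of the character. The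
  L-series is therefore a polynomial of degree at most \<open>d - 1\<close>.\<close>

lemma L_coeff_eq_0:
  assumes t: "0 < t" "t < p" and k: "k \<ge> d"
  shows "L_coeff t k = 0"
proof -
  have c: "of_nat d * a d \<in> Fq" "- (of_nat d * a d) \<noteq> 0"
    using a_in a_d of_nat_d_nonzero by auto
  obtain \<delta> where \<delta>: "\<delta> \<in> Fq" "eps t (- (of_nat d * a d) * \<delta>) \<noteq> 1"
    using eps_nontrivial[OF t, of "- (of_nat d * a d)"] c by auto
  show ?thesis unfolding L_coeff_def
  proof (rule sum_eq_0_by_bij[OF bij_unit_polys_shift[OF d_pos k \<delta>(1)] _ \<delta>(2)])
    fix v assume v: "v \<in> unit_polys k"
    have "char_fun (v + fps_const \<delta> * fps_X ^ d) = char_fun v - of_nat d * a d * \<delta>"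
      using v d_pos by (subst char_fun_change_top[of v]) (auto simp: unit_polysD)
    then have "char_fun (v + fps_const \<delta> * fps_X ^ d) = char_fun v + (- (of_nat d * a d) * \<delta>)"
      by simp
    then show "chi t (v + fps_const \<delta> * fps_X ^ d) = eps t (- (of_nat d * a d) * \<delta>) * chi t v"
      unfolding chi_def using v c \<delta> by (subst eps_add[symmetric]) (auto intro!: char_fun_Fq simp: unit_polysD add.commute)
  qed
qed

text \<open>Substituting \<open>v w\<close> modulo \<open>T\<^sup>d\<close> for the second summation variable in \<open>|L|\<^sup>2\<close> leaves, for fixed \<open>w\<close>, the
  sum over \<open>v\<close> of an additive character that is linear in \<open>v\<close> and trivial only for \<open>w = 1\<close>.\<close>

lemma norm_L_coeff_top:
  assumes t: "0 < t" "t < p"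
  shows "L_coeff t (d - 1) * cnj (L_coeff t (d - 1)) = of_nat ((p ^ m) ^ (d - 1))"
proof -
  define k where "k = d - 1"
  define c where "c = of_nat d * a d"
  have c: "c \<in> Fq" "c \<noteq> 0" using a_in a_d of_nat_d_nonzero by (auto simp: c_def)
  define V where "V = unit_polys k"
  \<comment> \<open>Truncation modulo \<open>T ^ d\<close>, as \<open>k = d - 1\<close>. The
    constant term 1 of \<open>v\<close> makes truncated multiplication by \<open>v\<close> a
    permutation of \<open>V\<close>.\<close>
  define tr where "tr u = Abs_fps (\<lambda>i. if i \<le> k then u $ i else (0::'k))" for u
  have finV: "finite V" by (simp add: V_def)
  have mult_Fq: "(v * w) $ i \<in> Fq" if "v \<in> V" "w \<in> V" for v w i
    unfolding fps_mult_nth using that by (intro fixed_field_sum fixed_field_mult) (auto simp: V_def unit_polysD)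
  have bij: "bij_betw (\<lambda>w. tr (v * w)) V V" if v: "v \<in> V" for v
  proof -
    have sub: "(\<lambda>w. tr (v * w)) ` V \<subseteq> V"
    proof safe
      fix w assume w: "w \<in> V"
      show "tr (v * w) \<in> V"
        using mult_Fq[OF v w] v w by (auto simp: V_def unit_polys_def tr_def)
    qed
    have inj: "inj_on (\<lambda>w. tr (v * w)) V"
    proof (rule inj_onI)
      fix x y assume xy: "x \<in> V" "y \<in> V" "tr (v * x) = tr (v * y)"
      have "x $ i = y $ i" for i
      proof (induction i rule: less_induct)
        case (less i)
        show ?case
        proof (cases "i \<le> k")
          case True
          have "(v * x) $ i = (v * y) $ i"
            using arg_cong[OF xy(3), of "\<lambda>u. u $ i"] True by (simp add: tr_def)
          then have "v $ 0 * x $ i + (\<Sum>j=1..i. v $ j * x $ (i - j)) = v $ 0 * y $ i + (\<Sum>j=1..i. v $ j * y $ (i - j))"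
            by (simp add: fps_mult_nth sum.atLeast_Suc_atMost)
          moreover have "(\<Sum>j=1..i. v $ j * x $ (i - j)) = (\<Sum>j=1..i. v $ j * y $ (i - j))"
            using less by (intro sum.cong) auto
          ultimately show ?thesis using v by (simp add: V_def unit_polysD)
        next
          case False
          then show ?thesis using xy by (simp add: V_def unit_polysD)
        qed
      qed
      then show "x = y" by (simp add: fps_eq_iff)
    qed
    show ?thesis
      using inj sub finV by (simp add: bij_betw_def endo_inj_surj)
  qed
  \<comment> \<open>Truncation removes the coefficient of index \<open>d\<close> from
    \<open>v * w\<close>; by \<open>char_fun_change_top\<close> this costs exactly the last
    factor.\<close>
  have chi_tr: "chi t (tr (v * w)) = chi t v * chi t w * eps t (c * (v * w) $ d)" if v: "v \<in> V" and w: "w \<in> V" for v w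
  proof -
    have v0: "v $ 0 = 1" "w $ 0 = 1" using v w by (auto simp: V_def unit_polysD)
    have "char_fun (v * w) = char_fun (tr (v * w)) - of_nat d * a d * ((v * w) $ d - tr (v * w) $ d)"
      using v0 d_pos by (intro char_fun_change_top) (auto simp: tr_def k_def)
    moreover have "tr (v * w) $ d = 0" using d_pos by (simp add: tr_def k_def)
    ultimately have "char_fun (tr (v * w)) = char_fun v + char_fun w + c * (v * w) $ d"
      using v0 by (simp add: char_fun_mult c_def)
    moreover have "char_fun v \<in> Fq" "char_fun w \<in> Fq" "c * (v * w) $ d \<in> Fq"
      using v w c mult_Fq[OF v w] by (auto intro!: char_fun_Fq simp: V_def unit_polysD)
    ultimately show ?thesis by (simp add: chi_def eps_add)
  qed
  have chi_cnj: "cnj (chi t v) * chi t v = 1" for v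
    using complex_norm_square[of "chi t v"] by (simp add: chi_def mult.commute)
  have one_V: "1 \<in> V" by (auto simp: V_def unit_polys_def)
  have inner: "(\<Sum>v\<in>V. eps t (c * (v * w) $ d)) = 0" if w: "w \<in> V" "w \<noteq> 1" for w
  proof -
    obtain j where j: "w $ j \<noteq> (1 :: 'k fps) $ j" using w(2) by (auto simp: fps_eq_iff)
    have j0': "j \<noteq> 0"
    proof
      assume "j = 0"
      then show False using j unit_polysD(1)[of w k] w(1) by (simp add: V_def)
    qed
    then have wj: "w $ j \<noteq> 0" using j by simp
    have j0: "0 < j" "j \<le> k" using j0' wj unit_polysD(3)[of w k j] w(1) not_le by (auto simp: V_def)
    have "c * w $ j \<in> Fq" "c * w $ j \<noteq> 0" using c wj w by (auto simp: V_def unit_polysD)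
    then obtain \<delta> where \<delta>: "\<delta> \<in> Fq" "eps t (c * w $ j * \<delta>) \<noteq> 1"
      using eps_nontrivial[OF t] by metis
    \<comment> \<open>Coefficient \<open>d\<close> of \<open>v * w\<close> contains
      \<open>v $ (d - j) * w $ j\<close>, and \<open>d - j\<close> is the index of a free
      coefficient of \<open>v\<close>.\<close>
    have dj: "0 < d - j" "d - j \<le> k" "j \<le> d" using j0 d_pos by (auto simp: k_def)
    show ?thesis
    proof (rule sum_eq_0_by_bij[OF _ _ \<delta>(2)])
      show "bij_betw (\<lambda>v. v + fps_const \<delta> * fps_X ^ (d - j)) V V"
        unfolding V_def by (rule bij_unit_polys_shift[OF dj(1,2) \<delta>(1)])
      fix v assume v: "v \<in> V"
      have "((v + fps_const \<delta> * fps_X ^ (d - j)) * w) $ d = (v * w) $ d + \<delta> * w $ j"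
        using dj by (simp add: distrib_right mult.assoc fps_X_power_mult_nth)
      then have "eps t (c * ((v + fps_const \<delta> * fps_X ^ (d - j)) * w) $ d)
          = eps t (c * w $ j * \<delta> + c * (v * w) $ d)" by (simp add: algebra_simps)
      also have "\<dots> = eps t (c * w $ j * \<delta>) * eps t (c * (v * w) $ d)"
        using c \<delta> mult_Fq[OF v w(1)] w by (intro eps_add) (auto simp: V_def unit_polysD)
      finally show "eps t (c * ((v + fps_const \<delta> * fps_X ^ (d - j)) * w) $ d)
          = eps t (c * w $ j * \<delta>) * eps t (c * (v * w) $ d)" .
    qed
  qed
  have "L_coeff t k * cnj (L_coeff t k) = (\<Sum>v\<in>V. cnj (chi t v) * (\<Sum>w\<in>V. chi t w))"
    by (simp add: L_coeff_def V_def sum_distrib_right[symmetric] mult.commute)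
  also have "\<dots> = (\<Sum>v\<in>V. cnj (chi t v) * (\<Sum>w\<in>V. chi t (tr (v * w))))"
    using sum.reindex_bij_betw[OF bij, of _ "chi t"] by simp
  also have "\<dots> = (\<Sum>v\<in>V. \<Sum>w\<in>V. chi t w * eps t (c * (v * w) $ d))"
  proof (rule sum.cong[OF refl])
    fix v assume v: "v \<in> V"
    show "cnj (chi t v) * (\<Sum>w\<in>V. chi t (tr (v * w))) = (\<Sum>w\<in>V. chi t w * eps t (c * (v * w) $ d))"
      unfolding sum_distrib_left
    proof (rule sum.cong[OF refl])
      fix w assume w: "w \<in> V"
      have "cnj (chi t v) * chi t (tr (v * w)) = (cnj (chi t v) * chi t v) * (chi t w * eps t (c * (v * w) $ d))"
        by (simp only: chi_tr[OF v w] mult.assoc)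
      then show "cnj (chi t v) * chi t (tr (v * w)) = chi t w * eps t (c * (v * w) $ d)"
        by (simp only: chi_cnj mult_1_left)
    qed
  qed
  also have "\<dots> = (\<Sum>w\<in>V. chi t w * (\<Sum>v\<in>V. eps t (c * (v * w) $ d)))"
    by (subst sum.swap) (simp add: sum_distrib_left)
  also have "\<dots> = (\<Sum>w\<in>V. if w = 1 then of_nat (card V) else 0)"
  proof (rule sum.cong[OF refl])
    fix w assume w: "w \<in> V"
    show "chi t w * (\<Sum>v\<in>V. eps t (c * (v * w) $ d)) = (if w = 1 then of_nat (card V) else 0)"
    proof (cases "w = 1")
      case True
      have "eps t (c * (v * w) $ d) = 1" if "v \<in> V" for v
        using that True d_pos by (simp add: V_def unit_polysD k_def)
      then show ?thesis using True by (simp add: chi_def)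
    qed (use inner w in simp)
  qed
  also have "\<dots> = of_nat ((p ^ m) ^ k)" using finV one_V by (simp add: sum.delta V_def card_unit_polys)
  finally show ?thesis by (simp add: k_def)
qed

end

subsection \<open>The L-polynomial and character sums over extensions\<close>

text \<open>\<open>A\<close> lists reciprocal roots. Entries 0 contribute the factor 1, so the
  multisets of size \<open>k\<close> encode all polynomials of degree at most \<open>k\<close> with
  constant term 1.\<close>

definition lin_prod :: "'k::field multiset \<Rightarrow> 'k fps" where
  "lin_prod A = (\<Prod>x\<in>#A. 1 - fps_const x * fps_X)"

lemma lin_prod_empty [simp]: "lin_prod {#} = 1"
  and lin_prod_add_mset: "lin_prod (add_mset x A) = (1 - fps_const x * fps_X) * lin_prod A"
  and lin_prod_union: "lin_prod (A + B) = lin_prod A * lin_prod B"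
  by (simp_all add: lin_prod_def)

lemma lin_prod_nth_0 [simp]: "lin_prod A $ 0 = 1"
  by (induction A) (auto simp: lin_prod_add_mset)

lemma fps_log_deriv_lin_prod:
  "fps_log_deriv (lin_prod A) = Abs_fps (\<lambda>j. \<Sum>x\<in>#A. x ^ Suc j)"
proof (induction A)
  case (add x A)
  then show ?case
    by (simp add: lin_prod_add_mset fps_log_deriv_mult fps_log_deriv_linear fps_eq_iff)
qed (simp add: fps_eq_iff)

lemma degree_prod_linear: "degree (\<Prod>x\<in>#A. [:-x, 1:] :: 'k::field poly) = size A"
proof -
  have nz: "(\<Prod>x\<in>#A. [:-x, 1:]) \<noteq> (0 :: 'k::field poly)" for A :: "'k multiset"
    by (auto simp: prod_mset_zero_iff)
  show ?thesis
  proof (induction A)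
    case (add x A)
    have "degree ([:-x, 1:] * (\<Prod>x\<in>#A. [:-x, 1:])) = degree [:-x, 1:] + degree (\<Prod>x\<in>#A. [:-x, 1:])"
      by (rule degree_mult_eq[OF _ nz]) simp
    then show ?case using add by (simp del: mult_pCons_left)
  qed simp
qed

lemma lin_prod_altdef: "lin_prod A = fps_of_poly (reflect_poly (\<Prod>x\<in>#A. [:-x, 1:]))"
proof (induction A)
  case (add x A)
  have "reflect_poly [:-x, 1:] = [:1, -x:]"
    by (simp add: reflect_poly_pCons' monom_altdef)
  moreover have "fps_of_poly [:1, -x:] = 1 - fps_const x * fps_X"
    by (simp add: fps_of_poly_pCons)
  ultimately show ?case
    by (simp add: lin_prod_add_mset reflect_poly_mult fps_of_poly_mult add
        del: mult_pCons_left fps_of_poly_pCons)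
qed simp

lemma lin_prod_nth:
  "lin_prod A $ n = (if n > size A then 0 else coeff (\<Prod>x\<in>#A. [:-x, 1:]) (size A - n))"
  by (simp add: lin_prod_altdef coeff_reflect_poly degree_prod_linear)

lemma lin_prod_inj:
  assumes "size A = size B" "lin_prod A = lin_prod B"
  shows "A = B"
proof -
  have "coeff (\<Prod>x\<in>#A. [:-x, 1:]) i = coeff (\<Prod>x\<in>#B. [:-x, 1:]) i" for i
  proof (cases "i \<le> size A")
    case True
    then show ?thesis
      using arg_cong[OF assms(2), of "\<lambda>u. u $ (size B - i)"] assms(1)
      by (simp add: lin_prod_nth diff_diff_cancel not_less[THEN iffD2])
  next
    case False
    then show ?thesis using assms(1) by (simp add: coeff_eq_0 degree_prod_linear)
  qed
  then have "(\<Prod>x\<in>#A. [:-x, 1:]) = (\<Prod>x\<in>#B. [:-x, 1:])" by (rule poly_eqI)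
  then show ?thesis by (metis proots_prod_linear)
qed

lemma lin_prod_exists:
  fixes v :: "'k::alg_closed_field fps"
  assumes "v $ 0 = 1" "\<And>i. i > k \<Longrightarrow> v $ i = 0"
  obtains A where "size A = k" "lin_prod A = v"
proof -
  define P where "P = (\<Sum>i\<le>k. monom (v $ (k - i)) i)"
  have cP: "coeff P i = (if i \<le> k then v $ (k - i) else 0)" for i
    by (simp add: P_def coeff_sum sum.delta)
  have dP: "degree P = k"
    using cP assms(1) by (intro antisym degree_le le_degree) auto
  have "P \<noteq> 0" using cP[of k] assms(1) by auto
  then obtain A where A: "size A = degree P" "P = smult (lead_coeff P) (\<Prod>x\<in>#A. [:-x, 1:])"
    using alg_closed_imp_factorization by blast
  have PA: "P = (\<Prod>x\<in>#A. [:-x, 1:])" using A(2) cP[of k] dP assms(1) by simp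
  have "lin_prod A $ n = v $ n" for n
    using A(1) assms(2)[of n] by (simp add: lin_prod_nth PA[symmetric] cP dP)
  then show ?thesis using that A(1) dP by (simp add: fps_eq_iff)
qed

lemma count_image_mset_inj: "inj f \<Longrightarrow> count (image_mset f A) (f x) = count A x"
  by (induction A) (auto simp: inj_eq)

context artin_schreier
begin

abbreviation "q \<equiv> p ^ m"

definition fval :: "'k \<Rightarrow> 'k" where
  "fval x = (\<Sum>i\<in>{1..d}. a i * x ^ i)"

lemma char_fun_lin_prod: "char_fun (lin_prod A) = (\<Sum>x\<in>#A. fval x)"
proof (induction A)
  case (add x A)
  have "char_fun (1 - fps_const x * fps_X) = fval x"
    unfolding char_fun_def fps_log_deriv_linear fval_def
  proof (rule sum.cong[OF refl])
    fix i assume "i \<in> {1..d}"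
    then obtain j where "i = Suc j" by (cases i) auto
    then show "a i * Abs_fps (\<lambda>j. x ^ Suc j) $ (i - 1) = a i * x ^ i" by simp
  qed
  then show ?case using add by (simp add: lin_prod_add_mset char_fun_mult)
qed simp

lemma frob_pow_inj: "x ^ (q ^ n) = (y :: 'k) ^ (q ^ n) \<Longrightarrow> x = y"
  using frob_inj[of x "m * n" y] by (simp add: power_mult)

lemma frob_comp: "((x :: 'k) ^ (q ^ i)) ^ (q ^ j) = x ^ (q ^ (i + j))"
  by (simp add: power_add power_mult)

lemma fval_frob: "fval (x ^ (q ^ n)) = fval x ^ (q ^ n)"
proof -
  have "a i ^ (q ^ n) = a i" for i
    using fixed_field_mono[of m "m * n" "a i"] a_in by (simp add: fixed_field_def power_mult)
  moreover have "(x ^ i) ^ N = (x ^ N) ^ i" for i N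
    by (simp add: power_mult[symmetric] mult.commute)
  moreover have "fval x ^ (q ^ n) = (\<Sum>i\<in>{1..d}. (a i * x ^ i) ^ (q ^ n))"
    unfolding fval_def power_mult[symmetric] by (rule frob_sum)
  ultimately show ?thesis by (simp add: fval_def power_mult_distrib)
qed

text \<open>Monic polynomials over \<open>\<bbbF>\<^sub>q\<close> are encoded by their multisets of roots; \<open>orbit n x\<close> below is the
  multiset of roots of the characteristic polynomial over \<open>\<bbbF>\<^sub>q\<close> of an element \<open>x\<close> of the extension of degree \<open>n\<close>.\<close>

definition frob_msets :: "nat \<Rightarrow> 'k multiset set" where
  "frob_msets k = {A. size A = k \<and> image_mset (\<lambda>x. x ^ q) A = A}"

lemma lin_prod_frob: "lin_prod (image_mset (\<lambda>x. x ^ q) A) = Abs_fps (\<lambda>i. (lin_prod (A :: 'k multiset) $ i) ^ q)"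
proof (induction A)
  case empty
  show ?case using p_pos by (auto simp: fps_eq_iff)
next
  case (add x A)
  show ?case
  proof (rule fps_ext)
    fix n
    show "lin_prod (image_mset (\<lambda>x. x ^ q) (add_mset x A)) $ n
        = Abs_fps (\<lambda>i. (lin_prod (add_mset x A) $ i) ^ q) $ n"
      using frob_add[of "lin_prod A $ n" "- (x * lin_prod A $ (n - 1))" m]
      by (cases n) (simp_all add: lin_prod_add_mset add algebra_simps frob_minus power_mult_distrib del: add_uminus_conv_diff
            flip: diff_conv_add_uminus)
  qed
qed

text \<open>The Frobenius acts compatibly on roots and coefficients, so an invariant multiset of
  roots means coefficients fixed by the power \<open>q\<close>.\<close>

lemma frob_mset_iff: "size A = k \<Longrightarrow> A \<in> frob_msets k \<longleftrightarrow> lin_prod A \<in> unit_polys k"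
proof -
  assume k: "size A = k"
  have "A \<in> frob_msets k \<longleftrightarrow> lin_prod (image_mset (\<lambda>x. x ^ q) A) = lin_prod A"
    using k lin_prod_inj[of "image_mset (\<lambda>x. x ^ q) A" A] by (auto simp: frob_msets_def)
  also have "\<dots> \<longleftrightarrow> (\<forall>i. lin_prod A $ i \<in> Fq)"
    by (simp add: lin_prod_frob fps_eq_iff fixed_field_def)
  also have "\<dots> \<longleftrightarrow> lin_prod A \<in> unit_polys k"
  proof -
    have "\<forall>i>k. lin_prod A $ i = 0" by (simp add: lin_prod_nth k)
    then show ?thesis by (simp add: unit_polys_def)
  qed
  finally show ?thesis .
qed

lemma bij_lin_prod: "bij_betw lin_prod (frob_msets k) (unit_polys k)"
  unfolding bij_betw_def
proof (intro conjI subset_antisym)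
  show "inj_on lin_prod (frob_msets k)"
    by (auto simp: inj_on_def frob_msets_def intro: lin_prod_inj)
  show "lin_prod ` frob_msets k \<subseteq> unit_polys k"
    using frob_mset_iff by (auto simp: frob_msets_def)
  show "unit_polys k \<subseteq> lin_prod ` frob_msets k"
  proof
    fix v assume v: "v \<in> unit_polys k"
    obtain A where A: "size A = k" "lin_prod A = v"
      using lin_prod_exists[of v k] v by (auto simp: unit_polysD)
    then show "v \<in> lin_prod ` frob_msets k" using frob_mset_iff[of A k] v by auto
  qed
qed

lemma finite_frob_msets: "finite (frob_msets k)"
  using bij_betw_finite[OF bij_lin_prod[of k]] by simp

definition mset_chi :: "nat \<Rightarrow> 'k multiset \<Rightarrow> complex" where
  "mset_chi t A = eps t (\<Sum>x\<in>#A. fval x)"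

lemma L_coeff_msets: "L_coeff t k = (\<Sum>A\<in>frob_msets k. mset_chi t A)"
  unfolding L_coeff_def sum.reindex_bij_betw[OF bij_lin_prod, symmetric]
  by (simp add: mset_chi_def chi_def char_fun_lin_prod)

lemma sum_fval_Fq: "A \<in> frob_msets k \<Longrightarrow> (\<Sum>x\<in>#A. fval x) \<in> Fq"
  unfolding char_fun_lin_prod[symmetric]
  using bij_betwE[OF bij_lin_prod, of k] by (intro char_fun_Fq) (auto simp: unit_polysD)

lemma mset_chi_union:
  "A \<in> frob_msets k \<Longrightarrow> B \<in> frob_msets l \<Longrightarrow> mset_chi t (A + B) = mset_chi t A * mset_chi t B"
  by (simp add: mset_chi_def eps_add sum_fval_Fq)

section \<open>Frobenius orbits\<close>

primrec orbit :: "nat \<Rightarrow> 'k \<Rightarrow> 'k multiset" where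
  "orbit 0 x = {#}"
| "orbit (Suc n) x = add_mset (x ^ (q ^ n)) (orbit n x)"

lemma size_orbit [simp]: "size (orbit n x) = n"
  by (induction n) auto

lemma orbit_add: "x ^ (q ^ n) = x \<Longrightarrow> orbit (n + l) x = orbit n x + orbit l x"
  by (induction l) (auto simp: power_add power_mult)

lemma orbit_mult: "x ^ (q ^ e) = x \<Longrightarrow> orbit (e * j) x = repeat_mset j (orbit e x)"
  by (induction j) (auto simp: orbit_add)

text \<open>The Frobenius raises each exponent by one, so the multisets differ only at the ends;
  avoiding subtraction suits the induction.\<close>

lemma orbit_frob: "image_mset (\<lambda>x. x ^ q) (orbit n x) + {#x#} = orbit n x + {#x ^ (q ^ n)#}"
proof (induction n)
  case (Suc n)
  have "(x ^ q ^ n) ^ q = x ^ (q ^ Suc n)" by (simp add: power_mult[symmetric] mult.commute)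
  then show ?case using Suc by simp
qed simp

lemma orbit_in_frob_msets: "x ^ (q ^ n) = x \<Longrightarrow> orbit n x \<in> frob_msets n"
  using orbit_frob[of n x] by (simp add: frob_msets_def)

lemma sum_orbit: "(\<Sum>y\<in>#orbit n x. fval y) = (\<Sum>i<n. fval x ^ (q ^ i))"
  by (induction n) (simp_all add: fval_frob add.commute)

lemma count_orbit: "count (orbit n x) y = card {i. i < n \<and> x ^ (q ^ i) = y}"
proof (induction n)
  case (Suc n)
  have "{i. i < Suc n \<and> x ^ (q ^ i) = y} =
      (if x ^ (q ^ n) = y then insert n {i. i < n \<and> x ^ (q ^ i) = y} else {i. i < n \<and> x ^ (q ^ i) = y})"
    by (auto simp: less_Suc_eq)
  then show ?case using Suc by simp
qed simp

lemma count_frob_mset: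
  assumes "A \<in> frob_msets k"
  shows "count A (x ^ (q ^ i)) = count A x"
proof (induction i)
  case (Suc i)
  have inj: "inj (\<lambda>x::'k. x ^ q)" using frob_pow_inj[of _ 1] by (auto intro: injI)
  have "count A ((x ^ (q ^ i)) ^ q) = count (image_mset (\<lambda>x. x ^ q) A) ((x ^ (q ^ i)) ^ q)"
    using assms by (simp add: frob_msets_def)
  also have "\<dots> = count A (x ^ (q ^ i))" using count_image_mset_inj[OF inj] .
  finally show ?case using Suc by (simp add: power_mult[symmetric] mult.commute)
qed simp

text \<open>Let \<open>e\<close> be the period of \<open>x\<close> under the Frobenius. Then
  \<open>n\<close> must be a multiple \<open>e * j\<close>, \<open>orbit (e * j) x\<close> consists
  of \<open>j\<close> copies of the conjugates of \<open>x\<close>, and these all have the same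
  multiplicity in \<open>A\<close>; so \<open>j\<close> runs from 1 to
  \<open>count A x\<close>.\<close>

lemma card_orbits_through:
  assumes A: "A \<in> frob_msets k"
  shows "card {n \<in> {1..k}. x ^ (q ^ n) = x \<and> orbit n x \<subseteq># A} = count A x"
proof (cases "x \<in># A")
  case False
  have "\<not> orbit n x \<subseteq># A" if "n \<in> {1..k}" for n
  proof
    assume sub: "orbit n x \<subseteq># A"
    have "x ^ (q ^ 0) = x" "0 < n" using that by auto
    then have "0 \<in> {i. i < n \<and> x ^ (q ^ i) = x}" by simp
    then have "count (orbit n x) x > 0" unfolding count_orbit by (auto simp: card_gt_0_iff)
    then show False using sub False by (meson count_greater_zero_iff mset_subset_eqD)
  qed
  then have "{n \<in> {1..k}. x ^ (q ^ n) = x \<and> orbit n x \<subseteq># A} = {}" by blast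
  moreover have "count A x = 0" using False by (simp add: not_in_iff)
  ultimately show ?thesis by (simp only: card.empty)
next
  case True
  \<comment> \<open>Finiteness of the invariant multiset \<open>A\<close> is what makes
    \<open>x\<close> periodic.\<close>
  have "(\<lambda>i. x ^ (q ^ i)) ` UNIV \<subseteq> set_mset A"
    using True count_frob_mset[OF A] by (metis (no_types, lifting) count_greater_zero_iff image_subsetI)
  then have "\<not> inj (\<lambda>i. x ^ (q ^ i))"
    using finite_subset finite_imageD by (metis finite_set_mset infinite_UNIV_nat)
  then obtain i j where "x ^ (q ^ i) = x ^ (q ^ j)" "i \<noteq> j" by (auto simp: inj_on_def)
  then obtain i j where ij: "x ^ (q ^ i) = x ^ (q ^ j)" "i < j" by (metis linorder_neqE_nat)
  have "(x ^ (q ^ (j - i))) ^ (q ^ i) = x ^ (q ^ i)"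
    using ij by (simp add: frob_comp)
  then have ex: "\<exists>n. n > 0 \<and> x ^ (q ^ n) = x" using frob_pow_inj ij(2) zero_less_diff by blast
  define e where "e = (LEAST n. n > 0 \<and> x ^ (q ^ n) = x)"
  have e: "e > 0" "x ^ (q ^ e) = x" using LeastI_ex[OF ex] by (auto simp: e_def)
  have e_least: "\<not> (0 < n \<and> x ^ (q ^ n) = x)" if "n < e" for n
    using not_less_Least that unfolding e_def by blast
  have ej: "x ^ (q ^ (e * j)) = x" for j
    by (induction j) (auto simp: power_add power_mult e)
  have period: "x ^ (q ^ n) = x \<longleftrightarrow> e dvd n" for n
  proof
    assume n: "x ^ (q ^ n) = x"
    have "x ^ (q ^ n) = (x ^ (q ^ (e * (n div e)))) ^ (q ^ (n mod e))"
      by (simp add: frob_comp)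
    then have "x ^ (q ^ (n mod e)) = x" using n ej by simp
    then have "n mod e = 0" using e_least[of "n mod e"] e(1) by auto
    then show "e dvd n" by auto
  qed (auto simp: ej)
  have count_e: "count (orbit e x) y = (if y \<in> (\<lambda>i. x ^ (q ^ i)) ` {..<e} then 1 else 0)" for y
  proof (cases "y \<in> (\<lambda>i. x ^ (q ^ i)) ` {..<e}")
    case True
    then obtain i where i: "i < e" "y = x ^ (q ^ i)" by auto
    have no_repeat: "\<not> (u < v \<and> v < e \<and> x ^ (q ^ u) = x ^ (q ^ v))" for u v
    proof
      assume uv: "u < v \<and> v < e \<and> x ^ (q ^ u) = x ^ (q ^ v)"
      then have "(x ^ (q ^ (v - u))) ^ (q ^ u) = x ^ (q ^ u)" by (simp add: frob_comp)
      then have fixed: "x ^ (q ^ (v - u)) = x" by (rule frob_pow_inj)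
      have "v - u < e" "0 < v - u" using uv by auto
      then show False using e_least[of "v - u"] fixed by simp
    qed
    have "j = i" if "j < e" "x ^ (q ^ j) = y" for j
      using i that no_repeat[of i j] no_repeat[of j i] by (cases i j rule: linorder_cases) auto
    then have "{i. i < e \<and> x ^ (q ^ i) = y} = {i}" using i by auto
    then show ?thesis using True by (simp add: count_orbit)
  next
    case False
    then have "{i. i < e \<and> x ^ (q ^ i) = y} = {}" by auto
    then show ?thesis using False by (simp only: count_orbit card.empty if_False)
  qed
  have sub_iff: "orbit (e * j) x \<subseteq># A \<longleftrightarrow> j \<le> count A x" for j
  proof -
    have "orbit (e * j) x \<subseteq># A \<longleftrightarrow> (\<forall>y. j * count (orbit e x) y \<le> count A y)"
      by (simp add: orbit_mult[OF e(2)] subseteq_mset_def)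
    also have "\<dots> \<longleftrightarrow> (\<forall>i<e. j \<le> count A (x ^ (q ^ i)))"
      by (auto simp: count_e)
    also have "\<dots> \<longleftrightarrow> j \<le> count A x" using e(1) by (auto simp: count_frob_mset[OF A])
    finally show ?thesis .
  qed
  have "{n \<in> {1..k}. x ^ (q ^ n) = x \<and> orbit n x \<subseteq># A} = (\<lambda>j. e * j) ` {1..count A x}"
  proof (intro subset_antisym subsetI)
    fix n assume n: "n \<in> {n \<in> {1..k}. x ^ (q ^ n) = x \<and> orbit n x \<subseteq># A}"
    then obtain j where j: "n = e * j" using period by (auto elim: dvdE)
    then show "n \<in> (\<lambda>j. e * j) ` {1..count A x}"
      using n sub_iff[of j] by (intro image_eqI[of _ _ j]) (auto simp: Suc_le_eq intro: gr0I)
  next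
    fix n assume "n \<in> (\<lambda>j. e * j) ` {1..count A x}"
    then obtain j where "n = e * j" "j \<in> {1..count A x}" by blast
    then have j: "n = e * j" "1 \<le> j" "j \<le> count A x" by auto
    then have sub: "orbit n x \<subseteq># A" using sub_iff by simp
    have "n \<le> k" using size_mset_mono[OF sub] A by (simp add: frob_msets_def)
    then show "n \<in> {n \<in> {1..k}. x ^ (q ^ n) = x \<and> orbit n x \<subseteq># A}"
      using sub j e ej by (auto simp: Suc_le_eq)
  qed
  then show ?thesis using e(1) by (simp add: card_image inj_on_def)
qed

definition char_sum :: "nat \<Rightarrow> nat \<Rightarrow> complex" where
  "char_sum t n = (\<Sum>x\<in>fixed_field (p ^ (m * n)). zeta ^ (t * residue (abs_trace (m * n) (fval x))))"

text \<open>The sum of \<open>fval\<close> over \<open>orbit n x\<close> is the relative trace of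
  \<open>fval x\<close>; transitivity of the trace does the rest.\<close>

lemma char_sum_orbits: "char_sum t n = (\<Sum>x | x ^ (q ^ n) = x. mset_chi t (orbit n x))"
proof -
  have "fixed_field (p ^ (m * n)) = {x :: 'k. x ^ (q ^ n) = x}"
    by (auto simp: fixed_field_def power_mult)
  then show ?thesis
    by (simp add: char_sum_def mset_chi_def sum_orbit eps_def abs_trace_mult)
qed

text \<open>Coefficients of T L'(T) = L(T) times the generating function of the character sums, by
  double counting instead of an Euler product. The pairs of \<open>n\<close> and \<open>x\<close>
  with \<open>orbit n x\<close> inside \<open>A\<close> number \<open>k\<close>, and removing such
  an orbit leaves an arbitrary member of \<open>frob_msets (k - n)\<close>.\<close>

lemma L_recurrence: "of_nat k * L_coeff t k = (\<Sum>n=1..k. char_sum t n * L_coeff t (k - n))"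
proof -
  define Y where "Y n = {x :: 'k. x ^ (q ^ n) = x}" for n
  have finY: "finite (Y n)" if "n > 0" for n
  proof -
    have "Y n = fixed_field (p ^ (m * n))" by (auto simp: Y_def fixed_field_def power_mult)
    then show ?thesis using finite_fixed_field[of "m * n"] m_pos that by simp
  qed
  have size_eq: "k = (\<Sum>n=1..k. card {x \<in> Y n. orbit n x \<subseteq># A})" if A: "A \<in> frob_msets k" for A
  proof -
    have Ysub: "{x \<in> Y n. orbit n x \<subseteq># A} \<subseteq> set_mset A" if "n \<in> {1..k}" for n
    proof safe
      fix x assume x: "x \<in> Y n" "orbit n x \<subseteq># A"
      have "n \<in> {n \<in> {1..k}. x ^ (q ^ n) = x \<and> orbit n x \<subseteq># A}" using x that by (auto simp: Y_def)
      then have "count A x > 0" unfolding card_orbits_through[OF A, symmetric] by (auto simp: card_gt_0_iff)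
      then show "x \<in># A" by simp
    qed
    have "k = size A" using A by (simp add: frob_msets_def)
    also have "\<dots> = (\<Sum>x\<in>set_mset A. count A x)" by (simp add: size_multiset_overloaded_eq)
    also have "\<dots> = (\<Sum>x\<in>set_mset A. card {n \<in> {1..k}. x ^ (q ^ n) = x \<and> orbit n x \<subseteq># A})"
      by (simp only: card_orbits_through[OF A])
    also have "\<dots> = (\<Sum>x\<in>set_mset A. \<Sum>n=1..k. if x ^ (q ^ n) = x \<and> orbit n x \<subseteq># A then 1 else 0)"
      by (simp add: sum.If_cases Int_def)
    also have "\<dots> = (\<Sum>n=1..k. \<Sum>x\<in>set_mset A. if x ^ (q ^ n) = x \<and> orbit n x \<subseteq># A then 1 else 0)"
      by (rule sum.swap)
    also have "\<dots> = (\<Sum>n=1..k. card {x \<in> Y n. orbit n x \<subseteq># A})"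
    proof (rule sum.cong[OF refl])
      fix n assume "n \<in> {1..k}"
      then have "{x \<in> Y n. orbit n x \<subseteq># A} = {x \<in> set_mset A. x ^ (q ^ n) = x \<and> orbit n x \<subseteq># A}"
        using Ysub by (auto simp: Y_def)
      then show "(\<Sum>x\<in>set_mset A. if x ^ (q ^ n) = x \<and> orbit n x \<subseteq># A then 1 else 0)
          = card {x \<in> Y n. orbit n x \<subseteq># A}"
        by (simp add: sum.If_cases Int_def)
    qed
    finally show ?thesis .
  qed
  have "of_nat k * L_coeff t k = (\<Sum>A\<in>frob_msets k. of_nat k * mset_chi t A)"
    by (simp add: L_coeff_msets sum_distrib_left)
  also have "\<dots> = (\<Sum>A\<in>frob_msets k. \<Sum>n=1..k. \<Sum>x\<in>Y n. if orbit n x \<subseteq># A then mset_chi t A else 0)"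
  proof (rule sum.cong[OF refl])
    fix A assume A: "A \<in> frob_msets k"
    have "(\<Sum>n=1..k. \<Sum>x\<in>Y n. if orbit n x \<subseteq># A then mset_chi t A else 0)
        = (\<Sum>n=1..k. of_nat (card {x \<in> Y n. orbit n x \<subseteq># A}) * mset_chi t A)"
      using finY by (intro sum.cong refl) (simp add: sum.If_cases Int_def)
    also have "\<dots> = of_nat (\<Sum>n=1..k. card {x \<in> Y n. orbit n x \<subseteq># A}) * mset_chi t A"
      by (simp add: sum_distrib_right)
    finally show "of_nat k * mset_chi t A = (\<Sum>n=1..k. \<Sum>x\<in>Y n. if orbit n x \<subseteq># A then mset_chi t A else 0)"
      by (simp only: size_eq[OF A, symmetric])
  qed
  also have "\<dots> = (\<Sum>n=1..k. \<Sum>x\<in>Y n. \<Sum>A\<in>frob_msets k. if orbit n x \<subseteq># A then mset_chi t A else 0)"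
    by (subst sum.swap) (intro sum.cong refl sum.swap)
  also have "\<dots> = (\<Sum>n=1..k. \<Sum>x\<in>Y n. mset_chi t (orbit n x) * L_coeff t (k - n))"
  proof (intro sum.cong refl)
    fix n x assume n: "n \<in> {1..k}" and x: "x \<in> Y n"
    have orb: "orbit n x \<in> frob_msets n" using x orbit_in_frob_msets by (simp add: Y_def)
    have bij: "bij_betw (\<lambda>B. orbit n x + B) (frob_msets (k - n)) {A \<in> frob_msets k. orbit n x \<subseteq># A}"
      by (rule bij_betwI[where g = "\<lambda>A. A - orbit n x"])
         (use n orb in \<open>auto simp: frob_msets_def size_Diff_submset image_mset_Diff\<close>)
    have "(\<Sum>A\<in>frob_msets k. if orbit n x \<subseteq># A then mset_chi t A else 0)
        = (\<Sum>A\<in>{A \<in> frob_msets k. orbit n x \<subseteq># A}. mset_chi t A)"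
      by (simp add: sum.inter_filter finite_frob_msets)
    also have "\<dots> = (\<Sum>B\<in>frob_msets (k - n). mset_chi t (orbit n x + B))"
      by (rule sum.reindex_bij_betw[OF bij, symmetric])
    also have "\<dots> = mset_chi t (orbit n x) * L_coeff t (k - n)"
      using mset_chi_union[OF orb] by (simp add: L_coeff_msets sum_distrib_left)
    finally show "(\<Sum>A\<in>frob_msets k. if orbit n x \<subseteq># A then mset_chi t A else 0)
        = mset_chi t (orbit n x) * L_coeff t (k - n)" .
  qed
  also have "\<dots> = (\<Sum>n=1..k. char_sum t n * L_coeff t (k - n))"
    by (simp add: char_sum_orbits Y_def sum_distrib_right)
  finally show ?thesis .
qed

end

subsection \<open>Power sums and the Serre bound\<close>

text \<open>Newton's identities: the negated power sums of \<open>W\<close> satisfy the same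
  recurrence, and its solution is unique because the coefficient of index 0 is 1.\<close>

lemma power_sums_unique:
  fixes W :: "'k::field multiset"
  assumes "\<And>k. of_nat k * lin_prod W $ k = (\<Sum>n=1..k. S n * lin_prod W $ (k - n))"
    and "n \<ge> 1"
  shows "S n = - (\<Sum>w\<in>#W. w ^ n)"
proof -
  define c where "c i = lin_prod W $ i" for i
  define s where "s n = (\<Sum>w\<in>#W. w ^ n)" for n
  have c0: "c 0 = 1" by (simp add: c_def)
  have "lin_prod W * inverse (lin_prod W) = 1" by (intro inverse_mult_eq_1') simp
  then have "fps_deriv (lin_prod W) = - (fps_log_deriv (lin_prod W) * lin_prod W)"
    by (simp add: fps_log_deriv_def mult.assoc) (metis mult.commute mult_1_right)
  then have der: "fps_deriv (lin_prod W) $ k = - (\<Sum>i=0..k. s (Suc i) * c (k - i))" for k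
    by (simp add: fps_log_deriv_lin_prod fps_mult_nth c_def s_def)
  have "(\<Sum>n=1..k. (S n + s n) * c (k - n)) = 0" for k
  proof (cases k)
    case (Suc j)
    have "of_nat k * c k = - (\<Sum>i=0..j. s (Suc i) * c (j - i))"
      using der[of j] by (simp add: c_def Suc)
    also have "(\<Sum>i=0..j. s (Suc i) * c (j - i)) = (\<Sum>n=1..k. s n * c (k - n))"
      unfolding Suc by (rule sum.reindex_bij_witness[of _ "\<lambda>n. n - 1" Suc]) auto
    finally show ?thesis using assms(1)[of k]
      by (simp add: c_def distrib_right sum.distrib)
  qed simp
  then have key: "(\<Sum>n=1..k. (S n + s n) * c (k - n)) = 0" for k .
  have "S n + s n = 0" if "n \<ge> 1" for n
    using that
  proof (induction n rule: less_induct)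
    case (less n)
    have "(\<Sum>i=1..n. (S i + s i) * c (n - i)) = (\<Sum>i\<in>{n}. (S i + s i) * c (n - i))"
      using less by (intro sum.mono_neutral_right) auto
    then show ?case using key[of n] c0 by simp
  qed
  then show ?thesis using assms(2) by (auto simp: s_def eq_neg_iff_add_eq_0)
qed

lemma Re_inverse_one_minus:
  assumes "norm z < 1"
  shows "Re (1 / (1 - z)) \<ge> 0"
proof -
  have "Re z < 1" using assms complex_Re_le_cmod[of z] by linarith
  then show ?thesis by (simp add: Re_divide)
qed

lemma sum_mset_geometric_sums:
  fixes c :: "'a \<Rightarrow> complex"
  assumes "\<And>w. w \<in># W \<Longrightarrow> norm (c w) < 1"
  shows "(\<lambda>n. \<Sum>w\<in>#W. c w ^ n) sums (\<Sum>w\<in>#W. 1 / (1 - c w))"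
  using assms
proof (induction W)
  case (add x W)
  have "(\<lambda>n. c x ^ n) sums (1 / (1 - c x))" using add.prems by (intro geometric_sums) auto
  then show ?case using add by (auto intro!: sums_add)
qed simp

text \<open>Otherwise a root \<open>u\<close> of maximal modulus would be a pole of the generating function of the
  power sums inside its disc of convergence; the other terms cannot cancel it on the ray through
  \<open>1 / u\<close>, since \<open>1 / (1 - z)\<close> has positive real part on the unit disc.\<close>

lemma norm_le_of_power_sums_bound:
  fixes W :: "complex multiset"
  assumes bound: "\<And>n. norm (\<Sum>w\<in>#W. w ^ n) \<le> C * \<rho> ^ n" and rho: "\<rho> \<ge> 0"
    and w: "w \<in># W"
  shows "norm w \<le> \<rho>"
proof (rule ccontr)
  assume gt: "\<not> norm w \<le> \<rho>"
  define R where "R = Max (norm ` set_mset W)"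
  have "R \<in> norm ` set_mset W" unfolding R_def using w by (intro Max_in) auto
  then obtain u where u: "u \<in># W" "norm u = R" by auto
  have maxR: "norm v \<le> R" if "v \<in># W" for v unfolding R_def using that by (intro Max_ge) auto
  have R: "R > \<rho>" "R > 0" using gt rho maxR[OF w] by auto
  have u0: "u \<noteq> 0" using u R by auto
  define r where "r = \<rho> / R"
  have r: "0 \<le> r" "r < 1" using R rho by (auto simp: r_def)
  have C0: "C \<ge> 0" using bound[of 0] order_trans[OF norm_ge_zero] by fastforce
  have main: "1 / (1 - s) \<le> C / (1 - r)" if s: "0 < s" "s < 1" for s :: real
  proof -
    \<comment> \<open>The generating function is evaluated at \<open>s / u\<close>, where the root
      \<open>u\<close> contributes \<open>1 / (1 - s)\<close>.\<close>
    define c where "c v = of_real s * v / u" for v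
    have nc: "norm (c v) < 1" if "v \<in># W" for v
    proof -
      have "norm (c v) = s * (norm v / R)" using u s by (simp add: c_def norm_mult norm_divide)
      also have "\<dots> \<le> s * 1" using maxR[OF that] R s by (intro mult_left_mono) auto
      finally show ?thesis using s by simp
    qed
    have sums: "(\<lambda>n. \<Sum>v\<in>#W. c v ^ n) sums (\<Sum>v\<in>#W. 1 / (1 - c v))"
      by (rule sum_mset_geometric_sums[OF nc])
    have nb: "norm (\<Sum>v\<in>#W. c v ^ n) \<le> C * r ^ n" for n
    proof -
      have "(\<Sum>v\<in>#W. c v ^ n) = (\<Sum>v\<in>#W. v ^ n) * (of_real s / u) ^ n"
      proof -
        have "c v ^ n = v ^ n * (of_real s / u) ^ n" for v
          by (simp add: c_def power_mult_distrib power_divide)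
        then show ?thesis by (simp only: sum_mset_distrib_right)
      qed
      then have "norm (\<Sum>v\<in>#W. c v ^ n) = norm (\<Sum>v\<in>#W. v ^ n) * (s / R) ^ n"
        using s u by (simp add: norm_mult norm_power norm_divide)
      also have "\<dots> \<le> (C * \<rho> ^ n) * (1 / R) ^ n"
        using bound[of n] s R C0 rho by (intro mult_mono power_mono divide_right_mono) auto
      also have "\<dots> = C * r ^ n" by (simp add: r_def power_divide)
      finally show ?thesis .
    qed
    have gs: "(\<lambda>n. C * r ^ n) sums (C * (1 / (1 - r)))"
      using r by (intro sums_mult geometric_sums) auto
    have "1 / (1 - s) = Re (1 / (1 - c u))" using u0 by (simp add: c_def Re_divide power2_eq_square)
    also have "\<dots> \<le> (\<Sum>v\<in>#W. Re (1 / (1 - c v)))"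
    proof -
      obtain W' where W': "W = add_mset u W'" using u(1) by (metis multi_member_split)
      have "(\<Sum>v\<in>#A. Re (1 / (1 - c v))) \<ge> 0" if "\<And>v. v \<in># A \<Longrightarrow> norm (c v) < 1" for A
        using that by (induction A) (auto intro!: add_nonneg_nonneg Re_inverse_one_minus)
      then have "(\<Sum>v\<in>#W'. Re (1 / (1 - c v))) \<ge> 0" using nc by (auto simp: W')
      then show ?thesis by (simp add: W')
    qed
    also have "\<dots> = Re (\<Sum>v\<in>#W. 1 / (1 - c v))"
      by (induction W) auto
    also have "\<dots> \<le> norm (\<Sum>v\<in>#W. 1 / (1 - c v))" by (rule complex_Re_le_cmod)
    also have "\<dots> = norm (suminf (\<lambda>n. \<Sum>v\<in>#W. c v ^ n))" using sums by (simp add: sums_iff)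
    also have "\<dots> \<le> suminf (\<lambda>n. C * r ^ n)"
      using nb sums_summable[OF gs] by (intro norm_suminf_le) auto
    also have "\<dots> = C / (1 - r)" using gs by (simp add: sums_iff)
    finally show ?thesis .
  qed
  define K where "K = C / (1 - r) + 1"
  have K: "K \<ge> 1" using C0 r by (simp add: K_def)
  \<comment> \<open>This \<open>s\<close> makes the left-hand side \<open>K + 1\<close>, while
    \<open>C / (1 - r)\<close> is \<open>K - 1\<close>.\<close>
  have "1 / (1 - (1 - 1 / (K + 1))) \<le> C / (1 - r)"
    using K by (intro main) (auto simp: field_simps)
  then show False using K by (simp add: K_def)
qed

text \<open>Adding up \<open>ln x \<le> x - 1\<close> over \<open>A\<close> avoids taking roots of
  the product.\<close>

lemma mset_am_gm_one:
  fixes A :: "real multiset"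
  assumes "\<And>x. x \<in># A \<Longrightarrow> x > 0" "prod_mset A \<ge> 1"
  shows "sum_mset A \<ge> real (size A)"
proof -
  have "ln (prod_mset A) \<le> sum_mset A - real (size A) \<and> prod_mset A > 0" using assms(1)
  proof (induction A)
    case (add x A)
    then have "ln (x * prod_mset A) = ln x + ln (prod_mset A)" "x > 0" "prod_mset A > 0"
      by (auto simp: ln_mult)
    moreover have "ln x \<le> x - 1" using add.prems by (intro ln_le_minus_one) auto
    ultimately show ?case using add by auto
  qed simp
  moreover have "ln (prod_mset A) \<ge> 0" using assms(2) by simp
  ultimately show ?thesis by linarith
qed

lemma power_sum_two_Ints:
  fixes x y :: complex
  assumes "x + y \<in> \<int>" "x * y \<in> \<int>"
  shows "x ^ n + y ^ n \<in> \<int>"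
proof -
  have "x ^ n + y ^ n \<in> \<int> \<and> x ^ Suc n + y ^ Suc n \<in> \<int>"
  proof (induction n)
    case (Suc n)
    have "x ^ Suc (Suc n) + y ^ Suc (Suc n) = (x + y) * (x ^ Suc n + y ^ Suc n) - x * y * (x ^ n + y ^ n)"
      by (simp add: algebra_simps)
    also have "\<dots> \<in> \<int>"
      using Ints_diff[OF Ints_mult[OF assms(1)] Ints_mult[OF assms(2)]] Suc by blast
    finally show ?case using Suc by blast
  qed (use assms in simp)
  then show ?thesis ..
qed

text \<open>Let \<open>G\<close> be the polynomial with roots \<open>W\<close> and \<open>\<beta>\<close> a root of \<open>X\<^sup>2 + M X + q\<close>. The functional equation of \<open>G\<close>
  turns \<open>\<Prod> (M + 2 Re w)\<close> into the square of \<open>H = G \<beta> / \<beta>\<^sup>g\<close> and makes \<open>H\<close> an integral combination of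
  the numbers \<open>\<beta>\<^sup>n + (q / \<beta>)\<^sup>n\<close>, which are integers.\<close>

lemma serre_bound:
  fixes W :: "complex multiset" and q g :: nat and M :: int
  assumes size_W: "size W = 2 * g" and q: "q > 0"
    and norm_W: "\<And>w. w \<in># W \<Longrightarrow> (norm w)\<^sup>2 = real q"
    and cnj_W: "image_mset cnj W = W"
    and ints: "\<And>k. lin_prod W $ k \<in> \<int>"
    and prod_W: "prod_mset W = of_nat (q ^ g)"
    and M: "real_of_int M > 2 * sqrt (real q)"
  shows "- (\<Sum>w\<in>#W. Re w) \<le> real g * (real_of_int M - 1)"
proof -
  have norm_W': "norm w = sqrt (real q)" if "w \<in># W" for w
    using norm_W[OF that] by (metis norm_ge_zero real_sqrt_unique)
  have W0: "w \<noteq> 0" if "w \<in># W" for w using norm_W[OF that] q by auto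
  have cnj_eq: "cnj w = of_nat q / w" if "w \<in># W" for w
  proof -
    have "w * cnj w = of_real ((norm w)\<^sup>2)" by (rule complex_norm_square[symmetric])
    then have "w * cnj w = of_nat q" using norm_W[OF that] by simp
    then show ?thesis using W0[OF that] by (simp add: field_simps)
  qed
  define G where "G = (\<Prod>w\<in>#W. [:-w, 1:])"
  have degG: "degree G = 2 * g" by (simp add: G_def degree_prod_linear size_W)
  have polyG: "poly G x = (\<Prod>w\<in>#W. x - w)" for x
    unfolding G_def by (induction W) (auto simp: algebra_simps)
  have G_ints: "coeff G i \<in> \<int>" for i
  proof (cases "i \<le> 2 * g")
    case True
    then have "lin_prod W $ (2 * g - i) = coeff G i"
      unfolding lin_prod_nth size_W G_def by (subst if_not_P) auto
    then show ?thesis using ints[of "2 * g - i"] by simp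
  qed (simp add: coeff_eq_0 degG)
  have prod_swap: "(\<Prod>w\<in>#W. w - x) = poly G x" for x
  proof -
    have "(\<Prod>w\<in>#A. w - x) = (-1) ^ size A * (\<Prod>w\<in>#A. x - w)" for A
      by (induction A) (auto simp: algebra_simps)
    from this[of W] show ?thesis by (simp add: size_W polyG)
  qed
  have func_eq: "poly G (of_nat q / x) * x ^ (2 * g) = of_nat (q ^ g) * poly G x" if x: "x \<noteq> 0" for x
  proof -
    have "poly G (of_nat q / x) = (\<Prod>w\<in>#image_mset cnj W. of_nat q / x - w)"
      by (simp add: polyG cnj_W)
    also have "\<dots> = (\<Prod>w\<in>#W. of_nat q / x - of_nat q / w)"
      unfolding image_mset.compositionality o_def
      by (intro arg_cong[where f = prod_mset] image_mset_cong) (simp add: cnj_eq)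
    finally have 1: "poly G (of_nat q / x) = (\<Prod>w\<in>#W. of_nat q / x - of_nat q / w)" .
    have "(\<Prod>w\<in>#A. of_nat q / x - of_nat q / w) * x ^ size A * prod_mset A = of_nat q ^ size A * (\<Prod>w\<in>#A. w - x)"
      if "\<And>w. w \<in># A \<Longrightarrow> w \<noteq> 0" for A
      using that
    proof (induction A)
      case (add y A)
      have y: "(of_nat q / x - of_nat q / y) * x * y = of_nat q * (y - x)"
        using add.prems x by (simp add: field_simps)
      have "(\<Prod>w\<in>#add_mset y A. of_nat q / x - of_nat q / w) * x ^ size (add_mset y A) * prod_mset (add_mset y A)
        = ((of_nat q / x - of_nat q / y) * x * y) * ((\<Prod>w\<in>#A. of_nat q / x - of_nat q / w) * x ^ size A * prod_mset A)"
        by (simp add: mult_ac)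
      also have "\<dots> = (of_nat q * (y - x)) * (of_nat q ^ size A * (\<Prod>w\<in>#A. w - x))"
        using add y by simp
      finally show ?case by (simp add: mult_ac)
    qed simp
    from this[of W] have "poly G (of_nat q / x) * x ^ (2 * g) * of_nat q ^ g = of_nat q ^ (2 * g) * poly G x"
      using W0 by (simp add: 1 size_W prod_W prod_swap)
    moreover have "(of_nat q :: complex) ^ (2 * g) = of_nat q ^ g * of_nat q ^ g" by (simp add: mult_2 power_add)
    ultimately have "(poly G (of_nat q / x) * x ^ (2 * g)) * of_nat q ^ g = (of_nat q ^ g * poly G x) * of_nat q ^ g"
      by (simp add: mult_ac)
    then show ?thesis using q by simp
  qed
  have coeff_eq: "coeff G i = of_nat (q ^ (g - i)) * coeff G (2 * g - i)" if i: "i \<le> g" for i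
  proof -
    define A where "A = (\<Sum>j\<le>2 * g. monom (coeff G j * of_nat q ^ j) (2 * g - j))"
    have "poly A x = of_nat (q ^ g) * poly G x" if x: "x \<noteq> 0" for x
    proof -
      have "poly A x = (\<Sum>j\<le>2 * g. coeff G j * of_nat q ^ j * x ^ (2 * g - j))"
        by (simp add: A_def poly_sum poly_monom)
      also have "\<dots> = (\<Sum>j\<le>2 * g. coeff G j * (of_nat q / x) ^ j * x ^ (2 * g))"
        using x by (intro sum.cong refl) (simp add: power_divide power_diff)
      also have "\<dots> = poly G (of_nat q / x) * x ^ (2 * g)"
        by (simp add: poly_altdef degG sum_distrib_right)
      finally show ?thesis using func_eq[OF x] by simp
    qed
    \<comment> \<open>\<open>func_eq\<close> is available only for \<open>x \<noteq> 0\<close>; the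
      factor X supplies the point 0.\<close>
    then have "poly (A * [:0, 1:]) x = poly (smult (of_nat (q ^ g)) G * [:0, 1:]) x" for x
      by (cases "x = 0") auto
    then have "A * [:0, 1:] = smult (of_nat (q ^ g)) G * [:0, 1:]" by (simp add: poly_eq_poly_eq_iff[symmetric] fun_eq_iff)
    then have AG: "A = smult (of_nat (q ^ g)) G" by (metis mult_cancel_right pCons_eq_0_iff zero_neq_one)
    have "coeff A i = (\<Sum>j\<le>2 * g. if j = 2 * g - i then coeff G j * of_nat q ^ j else 0)"
      unfolding A_def coeff_sum using i by (intro sum.cong refl) auto
    also have "\<dots> = coeff G (2 * g - i) * of_nat q ^ (2 * g - i)" by (simp add: sum.delta)
    finally have "of_nat q ^ g * coeff G i = coeff G (2 * g - i) * of_nat q ^ (2 * g - i)"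
      by (simp add: AG)
    moreover have "(of_nat q :: complex) ^ (2 * g - i) = of_nat q ^ g * of_nat q ^ (g - i)"
    proof -
      have "2 * g - i = g + (g - i)" using i by simp
      then show ?thesis by (simp only: power_add)
    qed
    ultimately have "of_nat q ^ g * coeff G i = of_nat q ^ g * (of_nat q ^ (g - i) * coeff G (2 * g - i))"
      by (simp only: mult_ac)
    then show ?thesis using q by simp
  qed
  define \<beta> where "\<beta> = (- of_int M + csqrt (of_int M ^ 2 - 4 * of_nat q)) / 2"
  define \<beta>' where "\<beta>' = (- of_int M - csqrt (of_int M ^ 2 - 4 * of_nat q)) / 2"
  have vieta: "\<beta> + \<beta>' = - of_int M" "\<beta> * \<beta>' = of_nat q"
  proof -
    show "\<beta> + \<beta>' = - of_int M" by (simp add: \<beta>_def \<beta>'_def field_simps)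
    have "\<beta> * \<beta>' = (of_int M ^ 2 - csqrt (of_int M ^ 2 - 4 * of_nat q) ^ 2) / 4"
      by (simp add: \<beta>_def \<beta>'_def field_simps power2_eq_square)
    then show "\<beta> * \<beta>' = of_nat q" by simp
  qed
  have b0: "\<beta> \<noteq> 0" using vieta(2) q by auto
  have b': "\<beta>' = of_nat q / \<beta>" using vieta(2) b0 by (simp add: field_simps)
  define H where "H = poly G \<beta> / \<beta> ^ g"
  have H_int: "H \<in> \<int>"
  proof -
    define T where "T i = coeff G i * \<beta> ^ i / \<beta> ^ g" for i
    have "H = (\<Sum>i\<le>2 * g. T i)"
      by (simp add: H_def T_def poly_altdef degG sum_divide_distrib)
    also have "\<dots> = (\<Sum>i<g. T i) + (\<Sum>i=g..2 * g. T i)"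
      by (subst sum.union_disjoint[symmetric]) (auto intro!: sum.cong)
    also have "(\<Sum>i=g..2 * g. T i) = T g + (\<Sum>i=Suc g..2 * g. T i)"
      by (rule sum.atLeast_Suc_atMost) simp
    also have "(\<Sum>i=Suc g..2 * g. T i) = (\<Sum>i<g. T (2 * g - i))"
      by (rule sum.reindex_bij_witness[of _ "\<lambda>i. 2 * g - i" "\<lambda>i. 2 * g - i"]) auto
    also have "(\<Sum>i<g. T i) + (T g + (\<Sum>i<g. T (2 * g - i))) = T g + (\<Sum>i<g. T i + T (2 * g - i))"
      by (simp add: sum.distrib)
    also have "\<dots> \<in> \<int>"
    proof (rule Ints_add[OF _ Ints_sum])
      show "T g \<in> \<int>" using b0 G_ints by (simp add: T_def)
      fix i assume i: "i \<in> {..<g}"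
      have "T i = of_nat q ^ (g - i) * coeff G (2 * g - i) * (\<beta> ^ i / \<beta> ^ g)"
        using coeff_eq[of i] i by (simp add: T_def)
      also have "\<beta> ^ i / \<beta> ^ g = 1 / \<beta> ^ (g - i)" using i b0 by (simp add: power_diff)
      finally have 1: "T i = coeff G (2 * g - i) * \<beta>' ^ (g - i)"
        by (simp add: b' power_divide)
      have "\<beta> ^ (2 * g - i) = \<beta> ^ (g - i) * \<beta> ^ g"
      proof -
        have "2 * g - i = (g - i) + g" using i by simp
        then show ?thesis by (simp only: power_add)
      qed
      then have 2: "T (2 * g - i) = coeff G (2 * g - i) * \<beta> ^ (g - i)"
        using b0 by (simp add: T_def)
      have "T i + T (2 * g - i) = coeff G (2 * g - i) * (\<beta> ^ (g - i) + \<beta>' ^ (g - i))"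
        unfolding 1 2 by (simp add: algebra_simps)
      also have "\<dots> \<in> \<int>"
        by (rule Ints_mult[OF G_ints power_sum_two_Ints]) (simp_all add: vieta)
      finally show "T i + T (2 * g - i) \<in> \<int>" .
    qed
    finally show ?thesis .
  qed
  \<comment> \<open>Since \<open>cnj w = q / w\<close>, each factor times \<open>w\<close> is
    \<open>w ^ 2 + M * w + q\<close>, which equals
    \<open>(\<beta> - w) * (\<beta>' - w)\<close>.\<close>
  have prod_H: "(\<Prod>w\<in>#W. complex_of_real (real_of_int M + 2 * Re w)) = H ^ 2"
  proof -
    have "(\<Prod>w\<in>#A. complex_of_real (real_of_int M + 2 * Re w)) * prod_mset A = (\<Prod>w\<in>#A. \<beta> - w) * (\<Prod>w\<in>#A. \<beta>' - w)"
      if "\<And>w. w \<in># A \<Longrightarrow> w \<in># W" for A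
      using that
    proof (induction A)
      case (add y A)
      have "complex_of_real (2 * Re y) = y + of_nat q / y"
        using cnj_eq[of y] complex_add_cnj[of y] add.prems by simp
      then have "complex_of_real (real_of_int M + 2 * Re y) * y = (of_int M + y + of_nat q / y) * y" by simp
      also have "\<dots> = y ^ 2 + of_int M * y + of_nat q"
        using W0[of y] add.prems by (simp add: distrib_right power2_eq_square)
      also have "\<dots> = y ^ 2 - (\<beta> + \<beta>') * y + \<beta> * \<beta>'" unfolding vieta by simp
      also have "\<dots> = (\<beta> - y) * (\<beta>' - y)" by (simp add: algebra_simps power2_eq_square)
      finally have y: "complex_of_real (real_of_int M + 2 * Re y) * y = (\<beta> - y) * (\<beta>' - y)" .
      have "(\<Prod>w\<in>#add_mset y A. complex_of_real (real_of_int M + 2 * Re w)) * prod_mset (add_mset y A)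
        = (complex_of_real (real_of_int M + 2 * Re y) * y) * ((\<Prod>w\<in>#A. complex_of_real (real_of_int M + 2 * Re w)) * prod_mset A)"
        by (simp add: mult_ac)
      also have "\<dots> = ((\<beta> - y) * (\<beta>' - y)) * ((\<Prod>w\<in>#A. \<beta> - w) * (\<Prod>w\<in>#A. \<beta>' - w))"
        using add y by simp
      finally show ?case by (simp add: mult_ac)
    qed simp
    from this[of W] have 1: "(\<Prod>w\<in>#W. complex_of_real (real_of_int M + 2 * Re w)) * of_nat q ^ g = poly G \<beta> * poly G \<beta>'"
      by (simp add: prod_W polyG)
    have "poly G \<beta>' * \<beta> ^ (2 * g) = of_nat q ^ g * poly G \<beta>"
      using func_eq[OF b0] by (simp add: b')
    then have "poly G \<beta>' = of_nat q ^ g * poly G \<beta> / \<beta> ^ (2 * g)" using b0 by (simp add: field_simps)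
    then have "poly G \<beta> * poly G \<beta>' = H ^ 2 * of_nat q ^ g"
      using b0 by (simp add: H_def power2_eq_square power_mult_distrib power_divide mult_2 power_add)
    then show ?thesis using 1 q by simp
  qed
  obtain h :: int where h: "H = of_int h" using H_int by (auto elim: Ints_cases)
  define B where "B = image_mset (\<lambda>w. real_of_int M + 2 * Re w) W"
  have B_pos: "x > 0" if x: "x \<in># B" for x
  proof -
    obtain w where w: "w \<in># W" "x = real_of_int M + 2 * Re w" using x by (auto simp: B_def)
    have "\<bar>Re w\<bar> \<le> sqrt (real q)" using abs_Re_le_cmod[of w] norm_W'[OF w(1)] by simp
    then show ?thesis using M w by linarith
  qed
  have "complex_of_real (prod_mset B) = (\<Prod>w\<in>#W. complex_of_real (real_of_int M + 2 * Re w))"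
    unfolding B_def by (induction W) auto
  also have "\<dots> = complex_of_real (real_of_int (h ^ 2))" using prod_H by (simp add: h)
  finally have ph: "prod_mset B = real_of_int (h ^ 2)" by (simp only: of_real_eq_iff)
  \<comment> \<open>The strict inequality for \<open>M\<close> makes every factor positive, so the
    integer \<open>h ^ 2\<close> is at least 1.\<close>
  have "0 \<notin># B" using B_pos by fastforce
  then have "h \<noteq> 0" using ph by (auto simp: prod_mset_zero_iff)
  then have "h ^ 2 \<ge> 1" by (metis int_one_le_iff_zero_less zero_less_power2)
  then have "prod_mset B \<ge> 1" unfolding ph by linarith
  then have "real (size B) \<le> sum_mset B" using B_pos by (rule mset_am_gm_one[rotated])
  moreover have "sum_mset B = real (size W) * real_of_int M + 2 * (\<Sum>w\<in>#W. Re w)"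
    unfolding B_def by (induction W) (auto simp: algebra_simps)
  moreover have "real (size B) = 2 * real g" by (simp add: B_def size_W)
  ultimately show ?thesis by (simp add: size_W algebra_simps)
qed

subsection \<open>The bound for the character sums\<close>

lemma lin_prod_sum: "finite T \<Longrightarrow> lin_prod (\<Sum>t\<in>T. A t) = (\<Prod>t\<in>T. lin_prod (A t))"
  by (induction T rule: finite_induct) (auto simp: lin_prod_union)

lemma lin_prod_cnj: "lin_prod (image_mset cnj A) = Abs_fps (\<lambda>i. cnj (lin_prod A $ i))"
proof (induction A)
  case (add x A)
  show ?case
  proof (rule fps_ext)
    fix n
    show "lin_prod (image_mset cnj (add_mset x A)) $ n = Abs_fps (\<lambda>i. cnj (lin_prod (add_mset x A) $ i)) $ n"
      by (cases n) (simp_all add: lin_prod_add_mset add algebra_simps)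
  qed
qed (auto simp: fps_eq_iff)

lemma lin_prod_nth_size: "lin_prod A $ size A = (-1) ^ size A * prod_mset A"
proof -
  have "poly (\<Prod>x\<in>#A. [:-x, 1:]) 0 = (-1) ^ size A * prod_mset A"
    by (induction A) (auto simp: algebra_simps)
  then show ?thesis by (simp add: lin_prod_nth poly_0_coeff_0)
qed

lemma mset_eq_of_prod_eq_power:
  fixes c :: real
  assumes "c > 0" "\<And>x. x \<in># A \<Longrightarrow> 0 \<le> x \<and> x \<le> c" "prod_mset A = c ^ size A" "x \<in># A"
  shows "x = c"
proof (rule ccontr)
  assume "x \<noteq> c"
  then have x: "x < c" "x \<ge> 0" using assms(2,4) by force+
  obtain B where B: "A = add_mset x B" using assms(4) by (metis multi_member_split)
  have "0 \<le> prod_mset B \<and> prod_mset B \<le> c ^ size B" if "\<And>x. x \<in># B \<Longrightarrow> 0 \<le> x \<and> x \<le> c" for B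
    using that
  proof (induction B)
    case (add y B)
    then have "0 \<le> y \<and> y \<le> c" "0 \<le> prod_mset B \<and> prod_mset B \<le> c ^ size B" by auto
    then show ?case using assms(1) by (auto intro!: mult_mono)
  qed simp
  then have "prod_mset B \<le> c ^ size B" using assms(2) by (auto simp: B)
  then have "x * prod_mset B \<le> x * c ^ size B" using x by (intro mult_left_mono)
  also have "\<dots> < c * c ^ size B" using x assms(1) by (intro mult_strict_right_mono) auto
  finally show False using assms(3) by (simp add: B)
qed

context char_p
begin

text \<open>The functions of \<open>u\<close> obtained from an element of \<open>\<nat>[\<zeta>]\<close> by substituting \<open>\<zeta> \<mapsto> \<zeta>\<^sup>u\<close> in a
  given expression for it; \<open>u = 0\<close> is allowed.\<close>

definition zeta_sum :: "(nat \<Rightarrow> complex) \<Rightarrow> bool" where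
  "zeta_sum Z \<longleftrightarrow> (\<exists>E. \<forall>u. Z u = (\<Sum>i\<in>#E. zeta ^ (i * u)))"

lemma zeta_sum_gen: "zeta_sum (\<lambda>u. zeta ^ (i * u))"
  unfolding zeta_sum_def by (rule exI[of _ "{#i#}"]) simp

lemma zeta_sum_0: "zeta_sum (\<lambda>u. 0)"
  unfolding zeta_sum_def by (rule exI[of _ "{#}"]) simp

lemma zeta_sum_1: "zeta_sum (\<lambda>u. 1)"
  using zeta_sum_gen[of 0] by simp

lemma zeta_sum_add: "zeta_sum Z \<Longrightarrow> zeta_sum Y \<Longrightarrow> zeta_sum (\<lambda>u. Z u + Y u)"
  unfolding zeta_sum_def
proof (elim exE)
  fix E F assume "\<forall>u. Z u = (\<Sum>i\<in>#E. zeta ^ (i * u))" "\<forall>u. Y u = (\<Sum>i\<in>#F. zeta ^ (i * u))"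
  then show "\<exists>G. \<forall>u. Z u + Y u = (\<Sum>i\<in>#G. zeta ^ (i * u))"
    by (intro exI[of _ "E + F"]) simp
qed

lemma zeta_sum_sum: "(\<And>i. i \<in> I \<Longrightarrow> zeta_sum (Z i)) \<Longrightarrow> zeta_sum (\<lambda>u. \<Sum>i\<in>I. Z i u)"
  by (induction I rule: infinite_finite_induct) (auto intro: zeta_sum_0 zeta_sum_add)

lemma zeta_sum_mult_gen: "zeta_sum Y \<Longrightarrow> zeta_sum (\<lambda>u. zeta ^ (i * u) * Y u)"
  unfolding zeta_sum_def
proof (elim exE)
  fix F assume "\<forall>u. Y u = (\<Sum>j\<in>#F. zeta ^ (j * u))"
  then show "\<exists>G. \<forall>u. zeta ^ (i * u) * Y u = (\<Sum>i\<in>#G. zeta ^ (i * u))"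
    by (intro exI[of _ "image_mset (\<lambda>j. i + j) F"])
       (simp add: sum_mset_distrib_left image_mset.compositionality o_def power_add distrib_right)
qed

lemma zeta_sum_mult: "zeta_sum Z \<Longrightarrow> zeta_sum Y \<Longrightarrow> zeta_sum (\<lambda>u. Z u * Y u)"
proof -
  assume Z: "zeta_sum Z" and Y: "zeta_sum Y"
  have "zeta_sum (\<lambda>u. (\<Sum>i\<in>#E. zeta ^ (i * u)) * Y u)" for E
  proof (induction E)
    case (add i E)
    then show ?case using zeta_sum_add[OF zeta_sum_mult_gen[OF Y, of i] add]
      by (simp add: distrib_right)
  qed (simp add: zeta_sum_0)
  moreover obtain E where "\<forall>u. Z u = (\<Sum>i\<in>#E. zeta ^ (i * u))" using Z by (auto simp: zeta_sum_def)
  ultimately show ?thesis by simp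
qed

lemma sum_zeta_sum:
  assumes "zeta_sum Z"
  shows "\<exists>b :: int. (\<Sum>u<p. Z u) = of_nat p * of_int b"
proof -
  have "\<exists>b :: int. (\<Sum>u<p. \<Sum>i\<in>#E. zeta ^ (i * u)) = of_nat p * of_int b" for E
  proof (induction E)
    case (add i E)
    then obtain b :: int where b: "(\<Sum>u<p. \<Sum>i\<in>#E. zeta ^ (i * u)) = of_nat p * of_int b" by blast
    have "(\<Sum>u<p. zeta ^ (i * u)) = of_nat p * of_int (if p dvd i then 1 else 0)"
      using sum_zeta[of i] by (simp add: mult.commute)
    then have "(\<Sum>u<p. \<Sum>i\<in>#add_mset i E. zeta ^ (i * u)) = of_nat p * of_int ((if p dvd i then 1 else 0) + b)"
      by (simp only: image_mset_add_mset sum_mset.add_mset sum.distrib b of_int_add distrib_left)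
    then show ?case by blast
  qed (auto intro: exI[of _ 0])
  moreover obtain E where "\<forall>u. Z u = (\<Sum>i\<in>#E. zeta ^ (i * u))" using assms by (auto simp: zeta_sum_def)
  ultimately show ?thesis by simp
qed

text \<open>This replaces Galois theory of the cyclotomic field. Summed over \<open>u < p\<close>,
  both \<open>Z u\<close> and \<open>zeta ^ ((p - 1) * u) * Z u\<close> give \<open>p\<close> times
  an integer. With \<open>Z\<close> constant on \<open>u > 0\<close> the totals are
  \<open>Z 0 + (p - 1) * Z 1\<close> and \<open>Z 0 - Z 1\<close>, and their difference is
  \<open>p * Z 1\<close>.\<close>

lemma zeta_sum_constant_Ints:
  assumes Z: "zeta_sum Z" and const: "\<And>u. 0 < u \<Longrightarrow> u < p \<Longrightarrow> Z u = Z 1"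
  shows "Z 1 \<in> \<int>"
proof -
  have split: "(\<Sum>u<p. F u) = F 0 + (\<Sum>u\<in>{1..<p}. F u)" for F :: "nat \<Rightarrow> complex"
    using p_pos by (simp add: lessThan_atLeast0 sum.atLeast_Suc_lessThan)
  obtain b :: int where b: "(\<Sum>u<p. Z u) = of_nat p * of_int b" using sum_zeta_sum[OF Z] by blast
  obtain c :: int where c: "(\<Sum>u<p. zeta ^ ((p - 1) * u) * Z u) = of_nat p * of_int c"
    using sum_zeta_sum[OF zeta_sum_mult_gen[OF Z, of "p - 1"]] by blast
  have "(\<Sum>u<p. Z u) = Z 0 + of_nat (p - 1) * Z 1"
  proof -
    have "(\<Sum>u\<in>{1..<p}. Z u) = (\<Sum>u\<in>{1..<p}. Z 1)" by (intro sum.cong refl const) auto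
    then show ?thesis unfolding split by simp
  qed
  then have 1: "Z 0 + of_nat (p - 1) * Z 1 = of_nat p * of_int b" using b by simp
  have "\<not> p dvd p - 1" using p_gt1 by (auto dest: dvd_imp_le)
  then have "(\<Sum>u<p. zeta ^ (u * (p - 1))) = 0" by (simp add: sum_zeta)
  then have z: "(\<Sum>u\<in>{1..<p}. zeta ^ ((p - 1) * u)) = -1"
    unfolding split by (simp add: mult.commute add_eq_0_iff)
  have "(\<Sum>u<p. zeta ^ ((p - 1) * u) * Z u) = Z 0 + (\<Sum>u\<in>{1..<p}. zeta ^ ((p - 1) * u)) * Z 1"
  proof -
    have "(\<Sum>u\<in>{1..<p}. zeta ^ ((p - 1) * u) * Z u) = (\<Sum>u\<in>{1..<p}. zeta ^ ((p - 1) * u) * Z 1)"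
      by (intro sum.cong refl arg_cong2[where f = "(*)"] const) auto
    then show ?thesis unfolding split sum_distrib_right by simp
  qed
  then have 2: "Z 0 - Z 1 = of_nat p * of_int c" using c z by simp
  have "of_nat p * Z 1 = (Z 0 + of_nat (p - 1) * Z 1) - (Z 0 - Z 1)"
    using p_pos by (cases p) (auto simp: algebra_simps)
  also have "\<dots> = of_nat p * (of_int b - of_int c)" by (simp only: 1 2 right_diff_distrib)
  finally have "of_nat p * Z 1 = of_nat p * (of_int b - of_int c)" .
  then have "Z 1 = of_int (b - c)" using p_pos by simp
  then show ?thesis by (simp only: Ints_of_int)
qed

lemma zeta_sum_prod_nth:
  assumes "finite T" "\<And>t k. t \<in> T \<Longrightarrow> zeta_sum (\<lambda>u. F t u $ k)"
  shows "zeta_sum (\<lambda>u. (\<Prod>t\<in>T. F t u) $ k)"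
  using assms
proof (induction T arbitrary: k rule: finite_induct)
  case empty
  show ?case by (cases "k = 0") (auto intro: zeta_sum_0 zeta_sum_1)
next
  case (insert t T)
  have "zeta_sum (\<lambda>u. \<Sum>i=0..k. F t u $ i * (\<Prod>t\<in>T. F t u) $ (k - i))"
    using insert by (intro zeta_sum_sum zeta_sum_mult) auto
  then show ?case using insert.hyps by (simp add: fps_mult_nth)
qed

lemma bij_mult_mod:
  assumes "0 < u" "u < p"
  shows "bij_betw (\<lambda>t. t * u mod p) {1..<p} {1..<p}"
proof -
  have cop: "coprime u p" using prime_p assms
    by (metis coprime_commute nat_dvd_not_less prime_imp_coprime)
  have sub: "(\<lambda>t. t * u mod p) ` {1..<p} \<subseteq> {1..<p}"
  proof safe
    fix t assume t: "t \<in> {1..<p}"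
    then have "\<not> p dvd t" "\<not> p dvd u" using assms by (auto dest: dvd_imp_le)
    then have "\<not> p dvd t * u" using prime_p by (simp add: prime_dvd_mult_iff)
    then show "t * u mod p \<in> {1..<p}" using p_pos by (auto simp: dvd_eq_mod_eq_0)
  qed
  have "inj_on (\<lambda>t. t * u mod p) {1..<p}"
  proof (rule inj_onI)
    fix x y assume xy: "x \<in> {1..<p}" "y \<in> {1..<p}" "x * u mod p = y * u mod p"
    then have "[x = y] (mod p)" using cong_mult_rcancel_nat[OF cop] by (simp add: cong_def)
    then show "x = y" using xy by (simp add: cong_def)
  qed
  then show ?thesis using sub by (simp add: bij_betw_def endo_inj_surj)
qed

end

context artin_schreier
begin

lemma L_coeff_mod: "L_coeff (t mod p) k = L_coeff t k"
proof -
  have "zeta ^ ((t mod p) * c) = zeta ^ (t * c)" for c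
    by (metis mod_mult_left_eq zeta_power_mod)
  then show ?thesis by (simp add: L_coeff_def chi_def eps_def)
qed

lemma L_coeff_cnj: "t < p \<Longrightarrow> cnj (L_coeff t k) = L_coeff (p - t) k"
  by (simp add: L_coeff_def chi_def eps_def cnj_zeta del: complex_cnj_power)

text \<open>For \<open>0 < t < p\<close> such a multiset exists because the coefficients vanish from
  index \<open>d\<close> on.\<close>

definition L_roots :: "nat \<Rightarrow> complex multiset" where
  "L_roots t = (SOME A. size A = d - 1 \<and> lin_prod A = Abs_fps (L_coeff t))"

lemma
  assumes "0 < t" "t < p"
  shows size_L_roots: "size (L_roots t) = d - 1"
    and lin_prod_L_roots: "lin_prod (L_roots t) = Abs_fps (L_coeff t)"
proof -
  have "\<exists>A. size A = d - 1 \<and> lin_prod A = Abs_fps (L_coeff t)"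
    using lin_prod_exists[of "Abs_fps (L_coeff t)" "d - 1"] L_coeff_eq_0[OF assms]
    by (auto simp: L_coeff_0)
  from someI_ex[OF this] show "size (L_roots t) = d - 1" "lin_prod (L_roots t) = Abs_fps (L_coeff t)"
    unfolding L_roots_def by blast+
qed

lemma char_sum_L_roots:
  assumes "0 < t" "t < p" "n \<ge> 1"
  shows "char_sum t n = - (\<Sum>w\<in>#L_roots t. w ^ n)"
  using assms(3) by (rule power_sums_unique[rotated]) (simp add: lin_prod_L_roots assms L_recurrence)

definition f_poly :: "'k poly" where
  "f_poly = (\<Sum>i\<in>{1..d}. monom (a i) i)"

lemma poly_f_poly: "poly f_poly x = fval x"
  by (simp add: f_poly_def fval_def poly_sum poly_monom)

lemma degree_f_poly: "degree f_poly = d"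
proof -
  have "coeff f_poly i = (if i \<in> {1..d} then a i else 0)" for i
    by (simp add: f_poly_def coeff_sum sum.delta)
  then show ?thesis using a_d d_pos by (intro antisym degree_le le_degree) auto
qed

lemma fval_in:
  assumes "x \<in> fixed_field (p ^ (m * n))"
  shows "fval x \<in> fixed_field (p ^ (m * n))"
  using assms fval_frob[of x n] by (simp add: fixed_field_def power_mult)

text \<open>Stepanov's method bounds the fibre sizes \<open>N c\<close> only from above. As the
  values \<open>zeta ^ (t * c)\<close> sum to 0, \<open>N c\<close> may be replaced by
  \<open>N c - B\<close>, which is never positive; the absolute values then add up to
  \<open>p * B - p ^ (2 * \<mu>)\<close>.\<close>

lemma char_sum_bound:
  assumes t: "0 < t" "t < p" and j: "j \<ge> 1"
  shows "norm (char_sum t (2 * j)) \<le> real (p * (2 * d + 1)) * real q ^ j"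
proof -
  define \<mu> where "\<mu> = m * j"
  have mu: "\<mu> > 0" "m * (2 * j) = 2 * \<mu>" using m_pos j by (auto simp: \<mu>_def)
  define F where "F = (fixed_field (p ^ (2 * \<mu>)) :: 'k set)"
  have finF: "finite F" and cardF: "card F = p ^ (2 * \<mu>)"
    using finite_fixed_field card_fixed_field mu by (auto simp: F_def)
  define \<rho> where "\<rho> x = residue (abs_trace (2 * \<mu>) (fval x))" for x
  define N where "N c = card {x \<in> F. \<rho> x = c}" for c
  define B where "B = p ^ (2 * \<mu> - 1) + (2 * d + 1) * p ^ \<mu>"
  have tr: "abs_trace (2 * \<mu>) (fval x) \<in> fixed_field p" if "x \<in> F" for x
    using that fval_in[of x "2 * j"] mu by (intro abs_trace_in) (simp add: F_def)
  have rho_less: "\<rho> x < p" if "x \<in> F" for x using residue_less[OF tr[OF that]] by (simp add: \<rho>_def)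
  have N_le: "N c \<le> B" if "c < p" for c
  proof -
    have "{x \<in> F. \<rho> x = c} = {x \<in> fixed_field (p ^ (2 * \<mu>)). abs_trace (2 * \<mu>) (poly f_poly x) = of_nat c}"
      using of_nat_residue[OF tr] residue_of_nat[OF that] by (auto simp: F_def \<rho>_def poly_f_poly)
    moreover have "\<not> p dvd d" using d_pos d_less by (auto dest: dvd_imp_le)
    ultimately show ?thesis using stepanov_bound[OF degree_f_poly _ mu(1)] by (simp add: N_def B_def)
  qed
  have group: "(\<Sum>x\<in>F. h (\<rho> x)) = (\<Sum>c<p. of_nat (N c) * h c)" for h :: "nat \<Rightarrow> complex"
  proof -
    have "(\<Sum>x\<in>F. h (\<rho> x)) = (\<Sum>c<p. \<Sum>x\<in>{x \<in> F. \<rho> x = c}. h (\<rho> x))"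
      by (rule sum.group[symmetric]) (use finF rho_less in auto)
    also have "\<dots> = (\<Sum>c<p. of_nat (N c) * h c)"
      by (intro sum.cong refl) (simp add: N_def)
    finally show ?thesis .
  qed
  have "complex_of_real (real (\<Sum>c<p. N c)) = complex_of_real (real (p ^ (2 * \<mu>)))"
    using group[of "\<lambda>_. 1"] by (simp add: cardF)
  then have sumN: "(\<Sum>c<p. N c) = p ^ (2 * \<mu>)" by (simp only: of_real_eq_iff of_nat_eq_iff)
  have "\<not> p dvd t" using t by (auto dest: dvd_imp_le)
  then have z: "(\<Sum>c<p. zeta ^ (t * c)) = 0" using sum_zeta[of t] by (simp add: mult.commute)
  have "char_sum t (2 * j) = (\<Sum>c<p. of_nat (N c) * zeta ^ (t * c))"
    unfolding char_sum_def mu(2) using group[of "\<lambda>c. zeta ^ (t * c)"] by (simp add: F_def \<rho>_def)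
  also have "\<dots> = - (\<Sum>c<p. of_real (real B - real (N c)) * zeta ^ (t * c))"
    using z by (simp add: sum_subtractf algebra_simps flip: sum_distrib_left)
  finally have "norm (char_sum t (2 * j)) \<le> (\<Sum>c<p. norm (of_real (real B - real (N c)) * zeta ^ (t * c)))"
    by (simp add: sum_norm_le)
  also have "\<dots> = (\<Sum>c<p. real B - real (N c))"
    using N_le by (intro sum.cong refl) (simp add: norm_mult del: of_real_diff)
  also have "\<dots> = real p * real B - real (\<Sum>c<p. N c)" by (simp add: sum_subtractf)
  also have "\<dots> = real (p * B) - real (p ^ (2 * \<mu>))" by (simp add: sumN)
  also have "p * B = p ^ (2 * \<mu>) + p * (2 * d + 1) * p ^ \<mu>"
  proof -
    have "p * p ^ (2 * \<mu> - 1) = p ^ (2 * \<mu>)" using mu(1) by (simp flip: power_Suc)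
    then show ?thesis by (simp add: B_def algebra_simps)
  qed
  finally show ?thesis by (simp add: \<mu>_def power_mult)
qed

lemma norm_L_roots:
  assumes t: "0 < t" "t < p" and w: "w \<in># L_roots t"
  shows "(norm w)\<^sup>2 = real q"
proof -
  \<comment> \<open>Only sums over extensions of even degree are bounded, so the growth argument is
    applied to the squares of the roots.\<close>
  have le: "norm (w ^ 2) \<le> real q" if w: "w \<in># L_roots t" for w
  proof (rule norm_le_of_power_sums_bound[where W = "image_mset (\<lambda>w. w ^ 2) (L_roots t)"])
    fix n
    show "norm (\<Sum>w\<in>#image_mset (\<lambda>w. w ^ 2) (L_roots t). w ^ n) \<le> real (p * (2 * d + 1)) * real q ^ n"
    \<comment> \<open>The power sum of exponent 0 is no character sum; it is \<open>d - 1\<close>,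
      which the constant exceeds.\<close>
    proof (cases "n = 0")
      case True
      have "d - 1 \<le> p * (2 * d + 1)" using p_pos by (cases p) auto
      then have "real (d - 1) \<le> real (p * (2 * d + 1))" by (simp only: of_nat_le_iff)
      moreover have "(\<Sum>w\<in>#A. w ^ 0) = of_nat (size A)" for A :: "complex multiset"
        by (induction A) auto
      ultimately show ?thesis using True by (simp only: size_image_mset size_L_roots[OF t] norm_of_nat) simp
    next
      case False
      have "(\<Sum>w\<in>#image_mset (\<lambda>w. w ^ 2) (L_roots t). w ^ n) = - char_sum t (2 * n)"
        using char_sum_L_roots[OF t, of "2 * n"] False
        by (simp add: image_mset.compositionality o_def power_mult)
      then show ?thesis using char_sum_bound[OF t, of n] False by simp
    qed
  qed (use w in auto)
  have "norm (L_coeff t (d - 1)) ^ 2 = real (q ^ (d - 1))"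
    using norm_L_coeff_top[OF t] unfolding complex_norm_square[symmetric]
    by (metis of_real_eq_iff of_real_of_nat_eq)
  moreover have "norm (L_coeff t (d - 1)) = norm (prod_mset (L_roots t))"
    using lin_prod_nth_size[of "L_roots t"]
    by (simp add: size_L_roots[OF t] lin_prod_L_roots[OF t] norm_mult norm_power)
  moreover have "norm (prod_mset A) ^ 2 = prod_mset (image_mset (\<lambda>w. (norm w)\<^sup>2) A)" for A :: "complex multiset"
    by (induction A) (auto simp: norm_mult power_mult_distrib)
  ultimately have prod: "prod_mset (image_mset (\<lambda>w. (norm w)\<^sup>2) (L_roots t))
      = real q ^ size (image_mset (\<lambda>w. (norm w)\<^sup>2) (L_roots t))"
    by (simp add: size_L_roots[OF t])
  show ?thesis
  proof (rule mset_eq_of_prod_eq_power[OF _ _ prod])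
    show "real q > 0" using p_pos by simp
    show "0 \<le> x \<and> x \<le> real q" if x: "x \<in># image_mset (\<lambda>w. (norm w)\<^sup>2) (L_roots t)" for x
    proof -
      obtain v where v: "v \<in># L_roots t" "x = (norm v)\<^sup>2" using x by auto
      show ?thesis using le[OF v(1)] unfolding v(2) norm_power by simp
    qed
  qed (use w in simp)
qed

lemma cnj_L_roots:
  assumes "0 < t" "t < p"
  shows "image_mset cnj (L_roots t) = L_roots (p - t)"
proof (rule lin_prod_inj)
  have pt: "0 < p - t" "p - t < p" using assms by auto
  show "size (image_mset cnj (L_roots t)) = size (L_roots (p - t))"
    using size_L_roots[OF assms] size_L_roots[OF pt] by simp
  show "lin_prod (image_mset cnj (L_roots t)) = lin_prod (L_roots (p - t))"
    using L_coeff_cnj[OF assms(2)]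
    by (simp add: lin_prod_cnj lin_prod_L_roots[OF assms] lin_prod_L_roots[OF pt])
qed

text \<open>The reciprocal roots of the numerator of the zeta function of y^p - y = f(x); their
  number is twice the genus.\<close>

definition all_roots :: "complex multiset" where
  "all_roots = (\<Sum>t\<in>{1..<p}. L_roots t)"

lemma all_roots_mem: "w \<in># all_roots \<longleftrightarrow> (\<exists>t\<in>{1..<p}. w \<in># L_roots t)"
  by (simp add: all_roots_def set_mset_sum)

lemma size_all_roots: "size all_roots = (p - 1) * (d - 1)"
proof -
  have "size all_roots = (\<Sum>t\<in>{1..<p}. size (L_roots t))"
    unfolding all_roots_def by (rule sum_comp_morphism[symmetric, unfolded o_def]) auto
  then show ?thesis by (simp add: size_L_roots)
qed

text \<open>Multiplying all \<open>t\<close> by \<open>u\<close> permutes the nonzero residues, so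
  the product over \<open>t\<close> is unchanged when \<open>zeta\<close> is replaced by
  \<open>zeta ^ u\<close>.\<close>

lemma lin_prod_all_roots_Ints: "lin_prod all_roots $ k \<in> \<int>"
proof -
  define Z where "Z u = (\<Prod>t\<in>{1..<p}. Abs_fps (L_coeff (t * u))) $ k" for u
  have "zeta_sum (\<lambda>u. L_coeff (t * u) k)" for t k
  proof -
    have "zeta_sum (\<lambda>u. \<Sum>v\<in>unit_polys k. zeta ^ ((t * residue (abs_trace m (char_fun v))) * u))"
      by (intro zeta_sum_sum zeta_sum_gen)
    then show ?thesis by (simp add: L_coeff_def chi_def eps_def mult_ac)
  qed
  then have "zeta_sum Z" unfolding Z_def by (intro zeta_sum_prod_nth) auto
  moreover have "Z u = Z 1" if u: "0 < u" "u < p" for u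
  proof -
    have "(\<Prod>t\<in>{1..<p}. Abs_fps (L_coeff (t * u))) = (\<Prod>t\<in>{1..<p}. Abs_fps (L_coeff (t * u mod p)))"
      using L_coeff_mod by (intro prod.cong refl) (simp add: fps_eq_iff)
    also have "\<dots> = (\<Prod>t\<in>{1..<p}. Abs_fps (L_coeff t))"
      by (rule prod.reindex_bij_betw[OF bij_mult_mod[OF u]])
    finally show ?thesis by (simp add: Z_def)
  qed
  ultimately have "Z 1 \<in> \<int>" by (rule zeta_sum_constant_Ints)
  moreover have "lin_prod all_roots = (\<Prod>t\<in>{1..<p}. Abs_fps (L_coeff t))"
    unfolding all_roots_def by (subst lin_prod_sum) (auto intro!: prod.cong simp: lin_prod_L_roots)
  ultimately show ?thesis by (simp add: Z_def)
qed

lemma cnj_all_roots: "image_mset cnj all_roots = all_roots"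
proof -
  have "image_mset cnj all_roots = (\<Sum>t\<in>{1..<p}. image_mset cnj (L_roots t))"
    unfolding all_roots_def by (rule sum_comp_morphism[symmetric, unfolded o_def]) auto
  also have "\<dots> = (\<Sum>t\<in>{1..<p}. L_roots (p - t))"
    by (intro sum.cong refl cnj_L_roots) auto
  also have "\<dots> = all_roots"
    unfolding all_roots_def by (rule sum.reindex_bij_witness[of _ "\<lambda>t. p - t" "\<lambda>t. p - t"]) auto
  finally show ?thesis .
qed

text \<open>For odd \<open>p\<close> the pairing of \<open>t\<close> with \<open>p - t\<close> has
  no fixed points. Partners have conjugate products, so each of the \<open>h\<close> pairs
  contributes the squared modulus \<open>q ^ (d - 1)\<close> of the top coefficient.\<close>

lemma prod_all_roots:
  assumes h: "p = 2 * h + 1"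
  shows "prod_mset all_roots = of_nat (q ^ (h * (d - 1)))"
proof -
  define P where "P t = prod_mset (L_roots t)" for t
  have P: "P t * P (p - t) = of_nat (q ^ (d - 1))" if t: "0 < t" "t < p" for t
  proof -
    have "prod_mset (image_mset cnj A) = cnj (prod_mset A)" for A :: "complex multiset"
      by (induction A) auto
    then have "P (p - t) = cnj (P t)" unfolding P_def cnj_L_roots[OF t, symmetric] .
    then have "P t * P (p - t) = of_real ((norm (P t))\<^sup>2)" by (simp only: complex_norm_square)
    also have "norm (P t) = norm (L_coeff t (d - 1))"
      using lin_prod_nth_size[of "L_roots t"]
      by (simp add: P_def size_L_roots[OF t] lin_prod_L_roots[OF t] norm_mult norm_power)
    also have "complex_of_real ((norm (L_coeff t (d - 1)))\<^sup>2) = of_nat (q ^ (d - 1))"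
      by (simp only: complex_norm_square norm_L_coeff_top[OF t])
    finally show ?thesis .
  qed
  have "prod_mset (\<Sum>t\<in>T. L_roots t) = (\<Prod>t\<in>T. P t)" if "finite T" for T
    using that by (induction T rule: finite_induct) (auto simp: P_def)
  then have "prod_mset all_roots = (\<Prod>t\<in>{1..<p}. P t)" by (simp add: all_roots_def)
  also have "\<dots> = (\<Prod>t\<in>{1..h} \<union> {h+1..2*h}. P t)" by (intro prod.cong) (auto simp: h)
  also have "\<dots> = (\<Prod>t\<in>{1..h}. P t) * (\<Prod>t\<in>{h+1..2*h}. P t)" by (rule prod.union_disjoint) auto
  also have "(\<Prod>t\<in>{h+1..2*h}. P t) = (\<Prod>t\<in>{1..h}. P (p - t))"
    by (rule prod.reindex_bij_witness[of _ "\<lambda>t. p - t" "\<lambda>t. p - t"]) (auto simp: h)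
  also have "(\<Prod>t\<in>{1..h}. P t) * \<dots> = (\<Prod>t\<in>{1..h}. P t * P (p - t))" by (simp only: prod.distrib)
  also have "\<dots> = (\<Prod>t\<in>{1..h}. of_nat (q ^ (d - 1)))" by (intro prod.cong refl P) (auto simp: h)
  also have "\<dots> = of_nat (q ^ (h * (d - 1)))" by (simp add: power_mult[symmetric] mult_ac)
  finally show ?thesis .
qed

lemma weil_serre:
  "(\<Sum>t\<in>{1..<p}. Re (char_sum t 1)) \<le> real (d - 1) * real (p - 1) / 2 * real_of_int \<lfloor>2 * sqrt (real q)\<rfloor>"
proof -
  have "(\<Sum>t\<in>{1..<p}. Re (char_sum t 1)) = - (\<Sum>t\<in>{1..<p}. \<Sum>w\<in>#L_roots t. Re w)"
  proof -
    have "Re (\<Sum>w\<in>#A. w) = (\<Sum>w\<in>#A. Re w)" for A by (induction A) auto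
    then have "Re (char_sum t 1) = - (\<Sum>w\<in>#L_roots t. Re w)" if "t \<in> {1..<p}" for t
      using that by (simp add: char_sum_L_roots)
    then show ?thesis by (simp add: sum_negf)
  qed
  also have "(\<Sum>t\<in>{1..<p}. \<Sum>w\<in>#L_roots t. Re w) = (\<Sum>w\<in>#all_roots. Re w)"
    unfolding all_roots_def by (rule sum_comp_morphism[unfolded o_def]) auto
  finally have eq: "(\<Sum>t\<in>{1..<p}. Re (char_sum t 1)) = - (\<Sum>w\<in>#all_roots. Re w)" .
  show ?thesis
  proof (cases "p = 2")
    \<comment> \<open>For \<open>p = 2\<close> the pairing breaks down, but \<open>d < p\<close>
      leaves only \<open>d = 1\<close> and hence no roots.\<close>
    case True
    then have "d = 1" using d_pos d_less by simp
    then have "all_roots = {#}" using size_all_roots by simp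
    then have "(\<Sum>t\<in>{1..<p}. Re (char_sum t 1)) = 0"
      unfolding eq by (simp only: image_mset_empty sum_mset.empty minus_zero)
    moreover have "real (d - 1) = 0" using \<open>d = 1\<close> by simp
    ultimately show ?thesis by (simp only: mult_zero_left div_0)
  next
    case False
    then have "odd p" using prime_p p_gt1 prime_odd_nat by auto
    then obtain h where h: "p = 2 * h + 1" by (auto elim: oddE)
    \<comment> \<open>The least integer above \<open>2 * sqrt q\<close>; then \<open>M - 1\<close>
      in \<open>serre_bound\<close> is the floor.\<close>
    define M where "M = \<lfloor>2 * sqrt (real q)\<rfloor> + 1"
    have "- (\<Sum>w\<in>#all_roots. Re w) \<le> real (h * (d - 1)) * (real_of_int M - 1)"
    proof (rule serre_bound[where q = q])
      show "size all_roots = 2 * (h * (d - 1))" by (subst size_all_roots) (simp add: h)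
      show "q > 0" using p_pos by simp
      show "(norm w)\<^sup>2 = real q" if w: "w \<in># all_roots" for w
      proof -
        obtain t where t: "t \<in> {1..<p}" "w \<in># L_roots t" using w unfolding all_roots_mem by blast
        then have "0 < t" "t < p" by auto
        then show ?thesis using t(2) by (rule norm_L_roots)
      qed
      show "real_of_int M > 2 * sqrt (real q)" unfolding M_def by linarith
    qed (auto simp only: cnj_all_roots lin_prod_all_roots_Ints prod_all_roots[OF h])
    moreover have "real (h * (d - 1)) = real (d - 1) * real (p - 1) / 2" by (simp add: h)
    ultimately show ?thesis unfolding eq M_def by (simp only: of_int_add of_int_1 add_diff_cancel_right')
  qed
qed

lemma card_trace_zero_bound:
  "real p * real (card {x \<in> Fq. abs_trace m (fval x) = 0})
    \<le> real q + real (d - 1) * real (p - 1) / 2 * real_of_int \<lfloor>2 * sqrt (real q)\<rfloor>"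
proof -
  define \<rho> where "\<rho> x = residue (abs_trace m (fval x))" for x
  have tr: "abs_trace m (fval x) \<in> fixed_field p" if "x \<in> Fq" for x
    using that fval_in[of x 1] by (intro abs_trace_in) simp
  have dvd_iff: "p dvd \<rho> x \<longleftrightarrow> abs_trace m (fval x) = 0" if "x \<in> Fq" for x
    using of_nat_residue[OF tr[OF that]] of_nat_eq_0_iff by (metis \<rho>_def)
  have cs: "char_sum t 1 = (\<Sum>x\<in>Fq. zeta ^ (t * \<rho> x))" for t
    by (simp add: char_sum_def \<rho>_def)
  have "(\<Sum>t<p. char_sum t 1) = (\<Sum>x\<in>Fq. \<Sum>t<p. zeta ^ (t * \<rho> x))"
    unfolding cs by (rule sum.swap)
  also have "\<dots> = (\<Sum>x\<in>Fq. if abs_trace m (fval x) = 0 then of_nat p else 0)"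
    by (intro sum.cong refl) (simp add: sum_zeta dvd_iff)
  also have "\<dots> = of_nat (p * card {x \<in> Fq. abs_trace m (fval x) = 0})"
    by (simp add: sum.If_cases Int_def)
  finally have total: "Re (\<Sum>t<p. char_sum t 1) = real p * real (card {x \<in> Fq. abs_trace m (fval x) = 0})"
    by simp
  have split: "(\<Sum>t<p. char_sum t 1) = char_sum 0 1 + (\<Sum>t\<in>{1..<p}. char_sum t 1)"
    using p_pos by (simp add: lessThan_atLeast0 sum.atLeast_Suc_lessThan)
  have cs0: "char_sum 0 1 = of_nat q" unfolding cs by (simp add: card_Fq)
  have "Re (\<Sum>t<p. char_sum t 1) = real q + (\<Sum>t\<in>{1..<p}. Re (char_sum t 1))"
    unfolding split cs0 by simp
  then have "real p * real (card {x \<in> Fq. abs_trace m (fval x) = 0}) = real q + (\<Sum>t\<in>{1..<p}. Re (char_sum t 1))"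
    using total by linarith
  then show ?thesis using weil_serre by linarith
qed

end

subsection \<open>Application to the code\<close>

lemma finite_field_power_card:
  fixes x :: "'a::{field,finite}"
  shows "x ^ CARD('a) = x"
proof (cases "x = 0")
  case True
  then show ?thesis by (simp add: power_0_left)
next
  case False
  have bij: "bij_betw (\<lambda>y. x * y) (UNIV - {0}) (UNIV - {0})"
    by (rule bij_betwI[where g = "\<lambda>y. y / x"]) (use False in auto)
  have "(\<Prod>y\<in>UNIV - {0::'a}. y) = (\<Prod>y\<in>UNIV - {0}. x * y)"
    by (rule prod.reindex_bij_betw[OF bij, symmetric])
  also have "\<dots> = x ^ (CARD('a) - 1) * (\<Prod>y\<in>UNIV - {0}. y)"
    by (simp add: prod.distrib card_Diff_singleton)
  finally have "x ^ (CARD('a) - 1) = 1" by (simp add: prod_zero_iff)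
  moreover have "CARD('a) = Suc (CARD('a) - 1)" by simp
  ultimately show ?thesis by (metis power_Suc mult_1_right)
qed

locale coordinates =
  fixes p m :: nat and \<phi> :: "'a::{field,finite} \<Rightarrow> nat \<Rightarrow> nat"
  assumes prime_p: "prime p" and card_a: "CARD('a) = p ^ m" and iso: "Fp_linear_iso p m \<phi>"
begin

lemma p_pos: "p > 0" using prime_p prime_gt_0_nat by auto

lemma phi_bij: "bij_betw \<phi> UNIV (coord_vectors p m)"
  and phi_add: "\<phi> (x + y) = (\<lambda>i. if i < m then (\<phi> x i + \<phi> y i) mod p else 0)"
  and phi_of_nat_mult: "c < p \<Longrightarrow> \<phi> (of_nat c * x) = (\<lambda>i. if i < m then (c * \<phi> x i) mod p else 0)"
  using iso by (auto simp: Fp_linear_iso_def)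

lemma phi_inj: "\<phi> x = \<phi> y \<Longrightarrow> x = y"
  using phi_bij by (auto simp: bij_betw_def inj_def)

lemma phi_less: "i < m \<Longrightarrow> \<phi> x i < p"
  and phi_ge: "i \<ge> m \<Longrightarrow> \<phi> x i = 0"
  using bij_betwE[OF phi_bij] by (auto simp: coord_vectors_def)

lemma phi_0: "\<phi> 0 = (\<lambda>_. 0)"
proof
  show "\<phi> 0 i = 0" for i
    using fun_cong[OF phi_of_nat_mult[of 0 0], of i] p_pos by (cases "i < m") simp_all
qed

lemma m_pos: "m > 0"
proof (rule ccontr)
  assume "\<not> m > 0"
  then have "card (UNIV :: 'a set) = 1" using card_a by simp
  then have "(0::'a) = 1" by (metis UNIV_I card_1_singletonE singletonD)
  then show False by simp
qed

text \<open>The coordinates of \<open>of_nat p\<close> are multiples of \<open>p\<close> reduced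
  modulo \<open>p\<close>, so the characteristic divides the prime \<open>p\<close>.\<close>

lemma CHAR_a: "CHAR('a) = p"
proof -
  have "\<phi> (of_nat n) = (\<lambda>i. if i < m then (n * \<phi> 1 i) mod p else 0)" for n
  proof (induction n)
    case (Suc n)
    then show ?case by (auto simp: phi_add fun_eq_iff mod_add_right_eq add.commute)
  qed (simp add: phi_0 fun_eq_iff)
  then have "\<phi> (of_nat p) = \<phi> 0" by (simp add: phi_0 fun_eq_iff)
  then have "of_nat p = (0::'a)" by (rule phi_inj)
  then have "CHAR('a) dvd p" by (simp add: of_nat_eq_0_iff_char_dvd)
  then show ?thesis using prime_p CHAR_not_1' by (metis One_nat_def prime_nat_iff)
qed

definition unit_vec :: "nat \<Rightarrow> 'a" where
  "unit_vec i = (SOME x. \<phi> x = (\<lambda>j. if j = i then 1 else 0))"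

lemma phi_unit_vec: "i < m \<Longrightarrow> \<phi> (unit_vec i) = (\<lambda>j. if j = i then 1 else 0)"
proof -
  assume "i < m"
  then have "(\<lambda>j. if j = i then 1 else 0) \<in> coord_vectors p m"
    using prime_gt_1_nat[OF prime_p] by (auto simp: coord_vectors_def)
  then have "\<exists>x. \<phi> x = (\<lambda>j. if j = i then 1 else 0)"
    using phi_bij by (auto simp: bij_betw_def) (metis imageE)
  then show ?thesis unfolding unit_vec_def by (rule someI_ex)
qed

lemma phi_expand: "y = (\<Sum>i<m. of_nat (\<phi> y i) * unit_vec i)"
proof (rule phi_inj)
  have "\<phi> (\<Sum>i\<in>S. of_nat (\<phi> y i) * unit_vec i)
      = (\<lambda>j. if j < m then (\<Sum>i\<in>S. \<phi> y i * \<phi> (unit_vec i) j) mod p else 0)"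
    if "finite S" "S \<subseteq> {..<m}" for S
    using that
  proof (induction S rule: finite_induct)
    case (insert i S)
    then show ?case
      by (auto simp: phi_add phi_of_nat_mult phi_less fun_eq_iff mod_add_eq)
  qed (simp add: phi_0 fun_eq_iff)
  from this[of "{..<m}"] have "\<phi> (\<Sum>i<m. of_nat (\<phi> y i) * unit_vec i)
      = (\<lambda>j. if j < m then (\<Sum>i<m. \<phi> y i * \<phi> (unit_vec i) j) mod p else 0)" by simp
  also have "\<dots> = \<phi> y"
  proof
    fix j
    have "(\<Sum>i<m. \<phi> y i * \<phi> (unit_vec i) j) = (\<Sum>i<m. if i = j then \<phi> y j else 0)"
      by (intro sum.cong) (auto simp: phi_unit_vec)
    then show "(if j < m then (\<Sum>i<m. \<phi> y i * \<phi> (unit_vec i) j) mod p else 0) = \<phi> y j"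
      by (auto simp: phi_less phi_ge)
  qed
  finally show "\<phi> y = \<phi> (\<Sum>i<m. of_nat (\<phi> y i) * unit_vec i)" by simp
qed

sublocale char_p p "TYPE('a alg_closure)"
  by standard (simp_all add: prime_p CHAR_a)

lemma range_to_ac: "range to_ac = (fixed_field (p ^ m) :: 'a alg_closure set)"
proof (rule card_subset_eq)
  show "finite (fixed_field (p ^ m) :: 'a alg_closure set)" using m_pos by (rule finite_fixed_field)
  show "range to_ac \<subseteq> (fixed_field (p ^ m) :: 'a alg_closure set)"
  proof safe
    fix x :: 'a
    have "to_ac x ^ (p ^ m) = to_ac (x ^ CARD('a))" by (simp add: card_a)
    then show "to_ac x \<in> fixed_field (p ^ m)"
      by (simp only: finite_field_power_card fixed_field_def mem_Collect_eq)
  qed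
  show "card (range to_ac :: 'a alg_closure set) = card (fixed_field (p ^ m) :: 'a alg_closure set)"
    by (simp add: card_image inj_to_ac card_fixed_field m_pos card_a)
qed

lemma to_ac_in [simp]: "to_ac x \<in> (fixed_field (p ^ m) :: 'a alg_closure set)"
  using range_to_ac by blast

lemma trace_in: "c \<in> fixed_field (p ^ m) \<Longrightarrow> abs_trace m (c * to_ac y) \<in> fixed_field p"
  by (intro abs_trace_in fixed_field_mult) auto

text \<open>Every \<open>\<bbbF>\<^sub>p\<close>-linear functional is \<open>y \<mapsto> Tr (c y)\<close> for some \<open>c\<close>: by nondegeneracy of the trace form
  there are \<open>p\<^sup>m\<close> functionals of this shape, and there are at most \<open>p\<^sup>m\<close> functionals altogether.\<close>

lemma functional_as_trace:
  assumes lam: "\<And>i. lam i < p"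
  obtains c where "c \<in> fixed_field (p ^ m)"
    "\<And>y. residue (abs_trace m (c * to_ac y)) = (\<Sum>i<m. lam i * \<phi> y i) mod p"
proof -
  define F where "F = (fixed_field (p ^ m) :: 'a alg_closure set)"
  define T where "T c = (\<lambda>y. residue (abs_trace m (c * to_ac y)))" for c
  define \<Lambda> where "\<Lambda> = Pi\<^sub>E {..<m} (\<lambda>_. {..<p})"
  define \<l> where "\<l> l = (\<lambda>y. (\<Sum>i<m. l i * \<phi> y i) mod p)" for l
  have "inj_on T F"
  proof (rule inj_onI, rule ccontr)
    fix b c assume bc: "b \<in> F" "c \<in> F" "T b = T c" "b \<noteq> c"
    obtain z where z: "z \<in> fixed_field (p ^ m)" "abs_trace m z \<noteq> 0"
      using abs_trace_nonzero[OF m_pos] .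
    have "z / (b - c) \<in> fixed_field (p ^ m)"
      using z bc by (auto simp: F_def intro: fixed_field_divide fixed_field_diff)
    then obtain y where y: "to_ac y = z / (b - c)" using range_to_ac by (metis imageE)
    have "abs_trace m (b * to_ac y) = abs_trace m (c * to_ac y)"
      using bc fun_cong[OF bc(3), of y] of_nat_residue[OF trace_in] by (metis F_def T_def)
    moreover have "b * to_ac y = c * to_ac y + z"
      using bc(4) by (simp add: y field_simps)
    ultimately show False using z(2) by (simp add: abs_trace_add)
  qed
  then have card_T: "card (T ` F) = p ^ m"
    by (simp add: card_image F_def card_fixed_field m_pos)
  have fin: "finite \<Lambda>" by (simp add: \<Lambda>_def finite_PiE)
  have "card \<Lambda> = p ^ m" by (simp add: \<Lambda>_def card_PiE)
  then have card_l: "card (\<l> ` \<Lambda>) \<le> p ^ m" using card_image_le[OF fin, of \<l>] by simp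
  have sub: "T ` F \<subseteq> \<l> ` \<Lambda>"
  proof safe
    fix c assume c: "c \<in> F"
    define l where "l i = residue (abs_trace m (c * to_ac (unit_vec i)))" for i
    have l: "abs_trace m (c * to_ac (unit_vec i)) = of_nat (l i)" "l i < p" for i
      using trace_in[of c] c of_nat_residue residue_less by (auto simp: l_def F_def)
    have "T c = \<l> (restrict l {..<m})"
    proof
      fix y
      have "to_ac y = (\<Sum>i<m. of_nat (\<phi> y i) * to_ac (unit_vec i))"
        by (subst phi_expand) (simp add: to_ac_sum)
      then have "abs_trace m (c * to_ac y) = (\<Sum>i<m. of_nat (\<phi> y i) * abs_trace m (c * to_ac (unit_vec i)))"
        by (simp add: sum_distrib_left abs_trace_sum mult.left_commute[of c] abs_trace_of_nat_mult)
      also have "\<dots> = of_nat (\<Sum>i<m. l i * \<phi> y i)" by (simp add: l mult.commute)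
      finally have "T c y = (\<Sum>i<m. l i * \<phi> y i) mod p"
        by (simp only: T_def residue_of_nat_mod)
      then show "T c y = \<l> (restrict l {..<m}) y" by (simp add: \<l>_def)
    qed
    moreover have "restrict l {..<m} \<in> \<Lambda>" using l(2) by (auto simp: \<Lambda>_def)
    ultimately show "T c \<in> \<l> ` \<Lambda>" by blast
  qed
  have eq: "T ` F = \<l> ` \<Lambda>"
    using sub fin card_T card_l by (intro card_seteq) auto
  have "restrict lam {..<m} \<in> \<Lambda>" using lam by (auto simp: \<Lambda>_def)
  then have "\<l> (restrict lam {..<m}) \<in> T ` F" using eq by blast
  then obtain c where c: "c \<in> F" "T c = \<l> (restrict lam {..<m})" by auto
  show ?thesis
  proof (rule that[of c])
    show "c \<in> fixed_field (p ^ m)" using c by (simp add: F_def)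
    show "residue (abs_trace m (c * to_ac y)) = (\<Sum>i<m. lam i * \<phi> y i) mod p" for y
      using fun_cong[OF c(2), of y] by (simp add: T_def \<l>_def)
  qed
qed

lemma zero_count_bound:
  fixes lam :: "nat \<Rightarrow> nat \<Rightarrow> nat" and r :: nat
  assumes lam: "\<And>k i. lam k i < p" and r: "r < p"
    and nz: "(\<Sum>k\<in>{1..r}. \<Sum>i<m. lam k i * \<phi> (x0 ^ k) i) mod p \<noteq> 0"
  shows "real p * real (card {x. (\<Sum>k\<in>{1..r}. \<Sum>i<m. lam k i * \<phi> (x ^ k) i) mod p = 0})
    \<le> real (p ^ m) + real (r - 1) * real (p - 1) / 2 * real_of_int \<lfloor>2 * sqrt (real (p ^ m))\<rfloor>"
proof -
  define val where "val x = (\<Sum>k\<in>{1..r}. \<Sum>i<m. lam k i * \<phi> (x ^ k) i)" for x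
  have "\<exists>c. c \<in> fixed_field (p ^ m) \<and> (\<forall>y. residue (abs_trace m (c * to_ac y)) = (\<Sum>i<m. lam k i * \<phi> y i) mod p)" for k
    using functional_as_trace[of "lam k"] lam by metis
  then obtain c where c: "\<And>k. c k \<in> fixed_field (p ^ m)"
    "\<And>k y. residue (abs_trace m (c k * to_ac y)) = (\<Sum>i<m. lam k i * \<phi> y i) mod p" by metis
  have tr: "abs_trace m (c k * to_ac y) = of_nat (\<Sum>i<m. lam k i * \<phi> y i)" for k y
    using of_nat_residue[OF trace_in[OF c(1)]] c(2) of_nat_mod_p by metis
  have tr_val: "abs_trace m (\<Sum>k\<in>{1..r}. c k * to_ac x ^ k) = of_nat (val x)" for x
    by (simp add: abs_trace_sum val_def tr flip: to_ac_power)
  have "\<exists>k\<in>{1..r}. c k \<noteq> 0"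
  proof (rule ccontr)
    assume "\<not> ?thesis"
    then have "(of_nat (val x0) :: 'a alg_closure) = 0" by (simp flip: tr_val)
    then show False using nz of_nat_eq_0_iff[of "val x0"] by (simp add: val_def dvd_eq_mod_eq_0)
  qed
  \<comment> \<open>The actual degree of the polynomial; the bound for \<open>d\<close> grows with
    \<open>d\<close>, so it passes to \<open>r\<close>.\<close>
  define d where "d = Max {k \<in> {1..r}. c k \<noteq> 0}"
  have "d \<in> {k \<in> {1..r}. c k \<noteq> 0}"
    unfolding d_def using \<open>\<exists>k\<in>{1..r}. c k \<noteq> 0\<close> by (intro Max_in) auto
  then have d: "1 \<le> d" "d \<le> r" "c d \<noteq> 0" by auto
  have above: "c k = 0" if "d < k" "k \<le> r" for k
  proof (rule ccontr)
    assume "c k \<noteq> 0"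
    then have "k \<le> d" unfolding d_def using that d by (intro Max_ge) auto
    then show False using that by simp
  qed
  interpret artin_schreier p "TYPE('a alg_closure)" m d c
    by standard (use m_pos d r c in auto)
  have "fval (to_ac x) = (\<Sum>k\<in>{1..r}. c k * to_ac x ^ k)" for x
    unfolding fval_def using d above by (intro sum.mono_neutral_left) auto
  then have fv: "abs_trace m (fval (to_ac x)) = of_nat (val x)" for x
    by (simp only: tr_val)
  have "{z \<in> fixed_field (p ^ m). abs_trace m (fval z) = 0} = to_ac ` {x. val x mod p = 0}"
    unfolding range_to_ac[symmetric]
    using fv of_nat_eq_0_iff by (auto simp: dvd_eq_mod_eq_0)
  then have "card {x. val x mod p = 0} = card {z \<in> fixed_field (p ^ m). abs_trace m (fval z) = 0}"
    by (simp add: card_image inj_to_ac inj_on_subset[OF inj_to_ac])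
  then have "real p * real (card {x. val x mod p = 0})
      \<le> real (p ^ m) + real (d - 1) * real (p - 1) / 2 * real_of_int \<lfloor>2 * sqrt (real (p ^ m))\<rfloor>"
    using card_trace_zero_bound by simp
  also have "\<dots> \<le> real (p ^ m) + real (r - 1) * real (p - 1) / 2 * real_of_int \<lfloor>2 * sqrt (real (p ^ m))\<rfloor>"
    using d by (intro add_left_mono mult_right_mono divide_right_mono) auto
  finally show ?thesis by (simp add: val_def)
qed

end

theorem theorem4p4:
  fixes p m r :: nat
    and \<phi> :: "'a::{field,finite} \<Rightarrow> nat \<Rightarrow> nat"
    and \<alpha> :: "nat \<Rightarrow> 'a"
  assumes "prime p"
    and "CARD('a) = p ^ m"
    and "1 \<le> r" and "r < p"
    and "Fp_linear_iso p m \<phi>"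
    and "bij_betw \<alpha> {0..<CARD('a) - 1} (UNIV - {0})"
  shows "1 + real p * (real (CARD('a)) - real (min_distance (row_space p m r \<phi> \<alpha>)))
         \<le> 1 + real (CARD('a)) + (real (r - 1) * real (p - 1) / 2) * real_of_int \<lfloor>2 * sqrt (real (CARD('a)))\<rfloor>"
proof -
  interpret coordinates p m \<phi> using assms by unfold_locales
  define val where "val lam x = (\<Sum>k\<in>{1..r}. \<Sum>i<m. lam k i * \<phi> (x ^ k) i) mod p" for lam x
  define word where "word lam = (\<lambda>j. if j < CARD('a) - 1 then val lam (\<alpha> j) else 0)" for lam
  have rs: "row_space p m r \<phi> \<alpha> = {word lam | lam. \<forall>k i. lam k i < p}"
    unfolding row_space_def word_def val_def by (intro Collect_cong ex_cong1) (rule conj_commute)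
  \<comment> \<open>The point 0 labels no column, but every codeword polynomial vanishes there, so
    weights can be counted over the whole field.\<close>
  have val_0: "val lam 0 = 0" for lam
    by (simp add: val_def phi_0 power_0_left)
  have weight: "hamming_weight (word lam) = card {x. val lam x \<noteq> 0}" for lam
  proof -
    have "bij_betw \<alpha> {j \<in> {0..<CARD('a) - 1}. val lam (\<alpha> j) \<noteq> 0} {x \<in> UNIV - {0}. val lam x \<noteq> 0}"
      using assms(6) by (rule bij_betw_Collect) auto
    then have "card {j \<in> {0..<CARD('a) - 1}. val lam (\<alpha> j) \<noteq> 0} = card {x \<in> UNIV - {0}. val lam x \<noteq> 0}"
      by (rule bij_betw_same_card)
    moreover have "{j. word lam j \<noteq> 0} = {j \<in> {0..<CARD('a) - 1}. val lam (\<alpha> j) \<noteq> 0}"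
      by (auto simp: word_def)
    moreover have "{x \<in> UNIV - {0}. val lam x \<noteq> 0} = {x. val lam x \<noteq> 0}"
      using val_0 by auto
    ultimately show ?thesis by (simp add: hamming_weight_def)
  qed
  define C where "C = row_space p m r \<phi> \<alpha> - {\<lambda>_. 0}"
  have "hamming_weight (word lam) \<le> CARD('a)" for lam
    unfolding weight by (rule card_mono) auto
  then have "hamming_weight ` C \<subseteq> {..CARD('a)}"
    by (auto simp: C_def rs)
  then have fin: "finite (hamming_weight ` C)" using finite_subset by blast
  have "C \<noteq> {}"
  proof -
    \<comment> \<open>The codeword given by the first coordinate of x, nonzero at
      \<open>unit_vec 0\<close>; it ensures that the minimum is attained.\<close>
    define lam :: "nat \<Rightarrow> nat \<Rightarrow> nat" where "lam k i = (if k = 1 \<and> i = 0 then 1 else 0)" for k i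
    have "unit_vec 0 \<noteq> 0"
      using phi_unit_vec[OF m_pos] phi_0 by (metis zero_neq_one)
    moreover have "\<alpha> ` {0..<CARD('a) - 1} = UNIV - {0}" using assms(6) by (rule bij_betw_imp_surj_on)
    ultimately have "unit_vec 0 \<in> \<alpha> ` {0..<CARD('a) - 1}" by blast
    then obtain j where j: "j < CARD('a) - 1" "\<alpha> j = unit_vec 0" by force
    have "(\<Sum>i<m. lam k i * \<phi> (unit_vec 0 ^ k) i) = (if k = 1 then 1 else 0)" for k
    proof -
      have "(\<Sum>i<m. lam k i * \<phi> (unit_vec 0 ^ k) i) = (\<Sum>i<m. if i = 0 then (if k = 1 then 1 else 0) else 0)"
        using phi_unit_vec[OF m_pos] by (intro sum.cong) (auto simp: lam_def)
      then show ?thesis using m_pos by (simp add: sum.delta)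
    qed
    then have "val lam (unit_vec 0) = 1"
      using assms(3) p_gt1 by (simp add: val_def sum.delta)
    then have "word lam j \<noteq> 0" using j by (simp add: word_def)
    then have "word lam \<noteq> (\<lambda>_. 0)" by auto
    moreover have "\<forall>k i. lam k i < p" using p_gt1 by (simp add: lam_def)
    ultimately have "word lam \<in> C" unfolding C_def rs by blast
    then show ?thesis by blast
  qed
  then have "min_distance (row_space p m r \<phi> \<alpha>) \<in> hamming_weight ` C"
    unfolding min_distance_def C_def[symmetric] using fin by (intro Min_in) auto
  then obtain c where c: "c \<in> C" "min_distance (row_space p m r \<phi> \<alpha>) = hamming_weight c" by blast
  then obtain lam where lam: "\<forall>k i. lam k i < p" "word lam \<noteq> (\<lambda>_. 0)" "c = word lam"
    unfolding C_def rs by blast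
  obtain j where "val lam (\<alpha> j) \<noteq> 0" using lam(2) by (auto simp: word_def fun_eq_iff split: if_splits)
  then have bound: "real p * real (card {x. val lam x = 0})
    \<le> real (p ^ m) + real (r - 1) * real (p - 1) / 2 * real_of_int \<lfloor>2 * sqrt (real (p ^ m))\<rfloor>"
    unfolding val_def using lam(1) assms(4) by (intro zero_count_bound) auto
  have diff: "real (CARD('a)) - real (min_distance (row_space p m r \<phi> \<alpha>)) = real (card {x. val lam x = 0})"
  proof -
    have "CARD('a) = card {x. val lam x = 0} + card {x. val lam x \<noteq> 0}"
      by (subst card_Un_disjoint[symmetric]) (auto intro!: arg_cong[where f = card])
    moreover have "min_distance (row_space p m r \<phi> \<alpha>) = card {x. val lam x \<noteq> 0}"
      using c(2) lam(3) weight by simp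
    ultimately show ?thesis by linarith
  qed
  show ?thesis unfolding diff unfolding assms(2) using bound by linarith
qed

end
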